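(* Let $\tilde\eta,\eta,j,\delta_j^*,\delta_j,\beta,\alpha_j,\delta_{\beta,j},\Delta_2,\Delta_1$ be chosen as described in the context, and let $M_0,M_1\subset[-\alpha_j,\alpha_j]\times[\Delta_1,\Delta_2]$ be the disjoint sets defined there. Then for every sequence $(s_n)_{n=-\infty}^{\infty}$ in $\{0,1\}$ there exist entire trajectories $(y_n)_{n=-\infty}^{\infty}$ of the return map in the plane $Q_j$ (that is, $y_{n+1}=Q_j(y_n)$ for all integers $n$) with $$y_n\in M_{s_n}\quad\text{for all integers } n.$$
   Context: BASIC SETTING. Let $\sigma<0<\mu$ and $u>0$ be reals with $\sigma+u>0$. $\mathbb{R}^n$ carries the Euclidean norm $|\cdot|$ and linear maps the operator norm. $e_1,e_2,e_3$ is the canonical basis of $\mathbb{R}^3$, $L=\mathbb{R}e_1\oplus\mathbb{R}e_2$, $U=\mathbb{R}e_3$; $P_L,P_U$ are the orthogonal projections of $\mathbb{R}^3$ onto $L$, $U$. Lower indices denote components; $\mathbb{N}=\{1,2,\dots\}$. A set $M$ is invariant under a flow $G$ in a set $N$ if for every $x\in M\cap N$ and every interval $J\ni0$ with $G(J\times\{x\})\subset N$ one has $G(J\times\{x\})\subset M$. $F:\mathbb{R}\times\mathbb{R}^3\to\mathbb{R}^3$ is a continuously differentiable flow (arising, by conjugation with a $C^1$ diffeomorphism of $\mathbb{R}^3$ fixing $0$, from the flow of a bounded $C^1$ vectorfield $V$ on $\mathbb{R}^3$ with $V(0)=0$, with a homoclinic solution, and with eigenvalues $u,\sigma\pm i\mu$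 of $DV(0)$), and $h:\mathbb{R}\to\mathbb{R}^3$ is a flowline of $F$ ($h(t+s)=F(t,h(s))$), such that: (F1) $F(t,0)=0$ for all $t$. (F2) $h(t)\ne0\ne h'(t)$ for all $t$ and $h(t)\to0$ as $|t|\to\infty$. (F3) $T(t)=D_2F(t,0)$ maps $L$ into $L$ and $U$ into $U$, and $y=T(t)x$ is given by $y_1=e^{\sigma t}(\cos(\mu t)x_1+\sin(\mu t)x_2)$, $y_2=e^{\sigma t}(-\sin(\mu t)x_1+\cos(\mu t)x_2)$, $y_3=e^{ut}x_3$. (F4) For some $r_F>0$, $L$ and $U$ are invariant under $F$ in $\{|x|<r_F\}$. (F5) There are $t_U<t_L$ with $h(t)\in(0,\infty)e_3$ for $t\le t_U$ and $h(t)\in L$ for $t\ge t_L$. For $\epsilon>0$ let $F_\epsilon(t,x)=\frac1\epsilon F(t,\epsilon x)$ and $h_\epsilon=\frac1\epsilon h$. Let $B_1=\{x:|P_Lx|\le1,|P_Ux|\le1\}$, $r_B=2(\max_{0\le t\le1}|T(t)|+e^u+2)$, $B=\{|x|\le r_B\}$. For each $\eta>0$ fix $\epsilon(\eta)>0$ such that $|D_2F_\epsilon(t,x)-T(t)|<\eta$ for all $0<\epsilon<\epsilon(\eta)$, $t\in[0,1]$, $x\in B_1$; fix $\epsilon_B>0$ such that for $0<\epsilon<\epsilon_B$, $F_\epsilon([0,1]\times B_1)\subset B$ and $L,U$ are invariant under $F_\epsilon$ in $B$ (such numbers exist). EXTERIOR MAPS. $M_I=\{z\in\mathbb{R}^3:|P_Lz|=1\}$,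 $M_E=e_3+L$, $M_E(r)=\{y\in M_E:|y-e_3|<r\}$. For $0<\epsilon<|h(t_U)|$ fix $t_{E,\epsilon}\le t_U$ with $h_\epsilon(t_{E,\epsilon})=e_3$. Fix strictly monotonic sequences $(t_{I,j})_{j\in\mathbb{N}}$ in $[t_L,\infty)$, $t_{I,j}\to\infty$, and $(\epsilon_j)_{j\in\mathbb{N}}$ in $(0,\infty)$, $\epsilon_j\to0$, with $\epsilon_j<|h(t_U)|$, $|h_{\epsilon_j}(t_{I,j})|=1$, $(|h_{\epsilon_j}|^2)'(t_{I,j})<0$, $h_{\epsilon_j}(t)\in L$ for $t\ge t_{I,j}$. Fix a decreasing sequence $r_j\to0$ of positive reals and $C^1$ maps $t_j:M_E(r_j)\to(0,\infty)$ with $t_j(e_3)=t_{I,j}-t_{E,\epsilon_j}$, $F_{\epsilon_j}(t_j(y),y)\in\{z\in M_I:P_Lz\ne-h_{\epsilon_j}(t_{I,j})\}$ and $\partial_1F_{\epsilon_j}(0,y)\notin L$ for all $y\in M_E(r_j)$. The exterior map is $E_j:M_E(r_j)\to\{z\in M_I:P_Lz\ne-h_{\epsilon_j}(t_{I,j})\}$, $E_j(y)=F_{\epsilon_j}(t_j(y),y)$; so $E_j(e_3)=h_{\epsilon_j}(t_{I,j})$. (All these objects exist.) CONDITIONS (C) on $\tilde\eta,\eta,j,\delta_j^*,\delta_j$: with $m(\eta,\sigma)=\max\{\log(1+\eta e^{-\sigma}),\log\frac{1}{1-\eta e^{-\sigma}},\arcsin\frac{\eta}{e^\sigma-\eta}\}$,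 one has $0<\eta<\frac{e^\sigma}{2}$, $1+\eta e^{-\sigma}<e^{-\sigma/2}$, $m(\eta,\sigma)<\tilde\eta$; $j\in\mathbb{N}$ with $\epsilon_j<\min\{\epsilon(\eta),\epsilon_B\}$; $\delta_j^*\in(0,1)$ with $1+\frac2\sigma\log(r_j)<\frac{1}{u+\log 2}\log\frac{1}{\delta_j^*}-1$; $\delta_j\in(0,\delta_j^* )$ with $\frac{1}{u+\log2}\log\frac1{\delta_j}-1>\frac{m(\eta,\sigma)}{\tilde\eta-m(\eta,\sigma)}$. INNER MAP. For $x\in M_I$ with $0<x_3<1$, $\tau_{\epsilon_j}(x)>0$ is the time with $0<F_{\epsilon_j,3}(s,x)<1$ for $0\le s<\tau_{\epsilon_j}(x)$ and $F_{\epsilon_j,3}(\tau_{\epsilon_j}(x),x)=1$ (it exists). $M_{I,j}=\{x\in M_I:0<x_3<\delta_j,\ P_Lx\ne-E_j(e_3)\}$, $\tau_j=\tau_{\epsilon_j}|_{M_{I,j}}$, $I_j:M_{I,j}\to M_E$, $I_j(x)=F_{\epsilon_j}(\tau_j(x),x)$, which has values in $M_E(r_j)$. COORDINATES. $\omega_j\in[-\pi,\pi)$ is given by $(\cos\omega_j,\sin\omega_j,0)=E_j(e_3)$. $K_j:(-\pi,\pi)\times\mathbb{R}\to\{x\in M_I:P_Lx\ne-E_j(e_3)\}$, $K_j(\psi,\delta)=(\cos(\omega_j+\psi),\sin(\omega_j+\psi),\delta)$, a $C^1$ diffeomorphism. The return map in the plane is $Q_j:(-\pi,\pi)\times(0,\delta_j)\to(-\pi,\pi)\times\mathbb{R}$,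 $Q_j=K_j^{-1}\circ E_j\circ I_j\circ K_j$. The derivative $T_{e_3}(K_j^{-1}\circ E_j):L\to\mathbb{R}^2$ is an isomorphism; $v_j,w_j\in L$ are the vectors it sends to $(1,0)$ and $(0,1)$. $\kappa_j:L\to\mathbb{R}^2$ is the isomorphism $\kappa_j(\xi v_j+\zeta w_j)=(\xi,\zeta)$, and $P_j$ is the restriction of $\kappa_j\circ P_L$ to $M_E(r_j)$, a diffeomorphism onto an open neighbourhood of $0$ in $\mathbb{R}^2$. For $\beta>0$, $\alpha_j(\beta)\in(0,\pi)$ denotes a number such that for all $p\in[-\alpha_j(\beta),\alpha_j(\beta)]^2$: $p\in P_j(M_E(r_j))$, $|(K_j^{-1}\circ E_j\circ P_j^{-1})(p)-p|\le\beta|p|$ and $|D(K_j^{-1}\circ E_j\circ P_j^{-1})(p)-\mathrm{id}|\le\beta$ (arbitrarily small such numbers exist). ANGLE FUNCTION. For $(\psi,\delta)\in(-\pi,\pi)\times(0,\delta_j)$ and $x=K_j(\psi,\delta)$ the path $t\mapsto P_LF_{\epsilon_j}(t,x)$ has no zero on $[0,\tau_j(x)]$; $\Phi_j(\psi,\delta)=\theta(\tau_j(x))$, where $\theta:[0,\tau_j(x)]\to\mathbb{R}$ is the unique continuous function with $\theta(0)=\omega_j+\psi$ and $P_LF_{\epsilon_j}(t,x)/|P_LF_{\epsilon_j}(t,x)|=(\cos\theta(t),\sin\theta(t),0)$. $\Phi_j$ is continuous. CHOICES. $0<\tilde\eta<\min\{\mu,-\sigma/2\}$; $c=\frac{(u+\tilde\eta)(\mu+\tilde\eta)}{(u-\tilde\eta)(\mu-\tilde\eta)}$,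 $k=e^{-6\pi\frac{u+\tilde\eta}{\mu-\tilde\eta}}$, and $\tilde\eta$ satisfies $c\,\frac{-\sigma+\tilde\eta}{u-\tilde\eta}<1$. $\eta,j,\delta_j^*,\delta_j$ satisfy (C). $\beta\in(0,1/2]$, $\alpha_j=\alpha_j(\beta)$ with $\alpha_j<\delta_j$, and $\delta_{\beta,j}=\left(\frac{2}{3(|\kappa_j|+1)}\alpha_j\right)^{3u/(-\sigma)}$ (which is $\le\frac23\alpha_j$). $\Delta_2\in(0,\delta_{\beta,j})$ satisfies $2\sqrt2\,\Delta_2<\frac{1}{|\kappa_j^{-1}|}k^{\frac{-\sigma+\tilde\eta}{u-\tilde\eta}}\Delta_2^{c\frac{-\sigma+\tilde\eta}{u-\tilde\eta}}$, and $\Delta_1=k\Delta_2^c$ $(<\Delta_2)$. With $m_1=\max_{|\gamma|\le\alpha_j}\Phi_j(\gamma,\Delta_1)$ and $m_2=\min_{|\psi|\le\alpha_j}\Phi_j(\psi,\Delta_2)$ one has $m_1+4\pi\le m_2$; $\psi_j\in[m_1+\pi,m_2-\pi]$ is chosen with $(\cos\psi_j,\sin\psi_j,0)=w_j/|w_j|$. Finally $M_0=\{(\psi,\delta)\in[-\alpha_j,\alpha_j]\times[\Delta_1,\Delta_2]:\psi_j-\pi<\Phi_j(\psi,\delta)<\psi_j\}$, $M_1=\{(\psi,\delta)\in[-\alpha_j,\alpha_j]\times[\Delta_1,\Delta_2]:\psi_j<\Phi_j(\psi,\delta)<\psi_j+\pi\}$. *)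

theory Defs
  imports "HOL-Analysis.Analysis"
begin

section \<open>Calculus and flows\<close>

text \<open>Continuous differentiability. It is used only for \<^term>\<open>S\<close> open, or open in an affine
  subspace; in the latter case the derivative is unique on the direction space only, and a continuous
  choice on the whole space exists iff the intrinsic derivative is continuous.\<close>

definition C1_on :: "('a::real_normed_vector \<Rightarrow> 'b::real_normed_vector) \<Rightarrow> 'a set \<Rightarrow> bool" where
  "C1_on f S \<longleftrightarrow> (\<exists>f' :: 'a \<Rightarrow> 'a \<Rightarrow>\<^sub>L 'b. continuous_on S f' \<and>
     (\<forall>x\<in>S. (f has_derivative blinfun_apply (f' x)) (at x within S)))"

definition C1_diffeo :: "('a::real_normed_vector \<Rightarrow> 'b::real_normed_vector) \<Rightarrow> bool" where
  "C1_diffeo R \<longleftrightarrow> bij R \<and> C1_on R UNIV \<and> C1_on (inv R) UNIV"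

definition is_flow :: "(real \<Rightarrow> 'a \<Rightarrow> 'a) \<Rightarrow> bool" where
  "is_flow F \<longleftrightarrow> (\<forall>x. F 0 x = x) \<and> (\<forall>s t x. F (t + s) x = F t (F s x))"

definition flow_of :: "('a::real_normed_vector \<Rightarrow> 'a) \<Rightarrow> (real \<Rightarrow> 'a \<Rightarrow> 'a) \<Rightarrow> bool" where
  "flow_of V G \<longleftrightarrow> (\<forall>x. G 0 x = x \<and>
     (\<forall>t. ((\<lambda>s. G s x) has_vector_derivative V (G t x)) (at t)))"

definition homoclinic_solution ::
    "('a::real_normed_vector \<Rightarrow> 'a) \<Rightarrow> (real \<Rightarrow> 'a) \<Rightarrow> bool" where
  "homoclinic_solution V c \<longleftrightarrow> (\<forall>t. (c has_vector_derivative V (c t)) (at t)) \<and>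
     (\<forall>t. c t \<noteq> 0) \<and> (c \<longlongrightarrow> 0) at_top \<and> (c \<longlongrightarrow> 0) at_bot"

definition complex_eigenvalue :: "real^'n^'n \<Rightarrow> complex \<Rightarrow> bool" where
  "complex_eigenvalue A z \<longleftrightarrow>
     (\<exists>v :: complex^'n. v \<noteq> 0 \<and> (\<chi> i j. complex_of_real (A $ i $ j)) *v v = z *s v)"

definition invariant_in :: "'a set \<Rightarrow> (real \<Rightarrow> 'a \<Rightarrow> 'a) \<Rightarrow> 'a set \<Rightarrow> bool" where
  "invariant_in M G N \<longleftrightarrow> (\<forall>x \<in> M \<inter> N. \<forall>J. is_interval J \<and> 0 \<in> J \<and> (\<lambda>t. G t x) ` J \<subseteq> N
     \<longrightarrow> (\<lambda>t. G t x) ` J \<subseteq> M)"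

definition D2 :: "(real \<Rightarrow> real^3 \<Rightarrow> real^3) \<Rightarrow> real \<Rightarrow> real^3 \<Rightarrow> real^3 \<Rightarrow> real^3" where
  "D2 F t x = frechet_derivative (F t) (at x)"

definition arises_from_homoclinic_vectorfield ::
    "real \<Rightarrow> real \<Rightarrow> real \<Rightarrow> (real \<Rightarrow> real^3 \<Rightarrow> real^3) \<Rightarrow> bool" where
  "arises_from_homoclinic_vectorfield \<sigma> \<mu> u F \<longleftrightarrow>
     (\<exists>(V :: real^3 \<Rightarrow> real^3) G R.
        bounded (range V) \<and> C1_on V UNIV \<and> V 0 = 0 \<and>
        {z. complex_eigenvalue (matrix (frechet_derivative V (at 0))) z}
          = {Complex u 0, Complex \<sigma> \<mu>, Complex \<sigma> (- \<mu>)} \<and>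
        (\<exists>c. homoclinic_solution V c) \<and>
        flow_of V G \<and> C1_diffeo R \<and> R 0 = 0 \<and>
        (\<forall>t x. F t x = R (G t (inv R x))))"


section \<open>Subsets of three-space\<close>

definition e3 :: "real^3" where "e3 = axis 3 1"

definition Lspace :: "(real^3) set" where "Lspace = span {axis 1 1, axis 2 1}"

definition Uspace :: "(real^3) set" where "Uspace = span {axis 3 1}"

definition PL :: "real^3 \<Rightarrow> real^3" where
  "PL x = (x $ 1) *\<^sub>R axis 1 1 + (x $ 2) *\<^sub>R axis 2 1"

definition PU :: "real^3 \<Rightarrow> real^3" where "PU x = (x $ 3) *\<^sub>R axis 3 1"

definition B1 :: "(real^3) set" where "B1 = {x. norm (PL x) \<le> 1 \<and> norm (PU x) \<le> 1}"

definition MI :: "(real^3) set" where "MI = {z. norm (PL z) = 1}"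

definition ME :: "real \<Rightarrow> (real^3) set" where
  "ME r = {y. y - e3 \<in> Lspace \<and> norm (y - e3) < r}"


section \<open>Scaled flow, inner map, exterior map, return map\<close>

definition scaled :: "(real \<Rightarrow> real^3 \<Rightarrow> real^3) \<Rightarrow> real \<Rightarrow> real \<Rightarrow> real^3 \<Rightarrow> real^3" where
  "scaled F \<epsilon> t x = (1 / \<epsilon>) *\<^sub>R F t (\<epsilon> *\<^sub>R x)"

text \<open>The supremum is a maximum, as \<^term>\<open>D2 F t 0\<close> is continuous in \<^term>\<open>t\<close>.\<close>

definition rB :: "(real \<Rightarrow> real^3 \<Rightarrow> real^3) \<Rightarrow> real \<Rightarrow> real" where
  "rB F u = 2 * ((SUP t\<in>{0..1}. onorm (D2 F t 0)) + exp u + 2)"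

text \<open>In the following, \<^term>\<open>F\<close> is a flow that is already scaled.\<close>

definition transit_time :: "(real \<Rightarrow> real^3 \<Rightarrow> real^3) \<Rightarrow> real^3 \<Rightarrow> real" where
  "transit_time F x = (THE t. 0 < t \<and> (\<forall>s\<in>{0..<t}. 0 < F s x $ 3 \<and> F s x $ 3 < 1) \<and> F t x $ 3 = 1)"

definition inner_map :: "(real \<Rightarrow> real^3 \<Rightarrow> real^3) \<Rightarrow> real^3 \<Rightarrow> real^3" where
  "inner_map F x = F (transit_time F x) x"

definition exterior_map :: "(real \<Rightarrow> real^3 \<Rightarrow> real^3) \<Rightarrow> (real^3 \<Rightarrow> real) \<Rightarrow> real^3 \<Rightarrow> real^3" where
  "exterior_map F T y = F (T y) y"

text \<open>In the following, \<^term>\<open>E\<close> is an exterior map; only its value at \<^term>\<open>e3\<close> matters for the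
  coordinates on the cylinder.\<close>

definition base_angle :: "(real^3 \<Rightarrow> real^3) \<Rightarrow> real" where
  "base_angle E = (THE \<omega>. -pi \<le> \<omega> \<and> \<omega> < pi \<and> vector [cos \<omega>, sin \<omega>, 0] = E e3)"

definition Kmap :: "(real^3 \<Rightarrow> real^3) \<Rightarrow> real \<times> real \<Rightarrow> real^3" where
  "Kmap E p = vector [cos (base_angle E + fst p), sin (base_angle E + fst p), snd p]"

definition Kinv :: "(real^3 \<Rightarrow> real^3) \<Rightarrow> real^3 \<Rightarrow> real \<times> real" where
  "Kinv E = inv_into ({-pi<..<pi} \<times> UNIV) (Kmap E)"

definition return_map ::
    "(real \<Rightarrow> real^3 \<Rightarrow> real^3) \<Rightarrow> (real^3 \<Rightarrow> real^3) \<Rightarrow> real \<times> real \<Rightarrow> real \<times> real" where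
  "return_map F E = Kinv E \<circ> E \<circ> inner_map F \<circ> Kmap E"

text \<open>Tangent map at \<^term>\<open>e3\<close>, on \<^term>\<open>Lspace\<close>, of a map defined on the affine plane
  through \<^term>\<open>e3\<close> parallel to \<^term>\<open>Lspace\<close>.\<close>

definition tangent_e3 :: "(real^3 \<Rightarrow> real \<times> real) \<Rightarrow> real^3 \<Rightarrow> real \<times> real" where
  "tangent_e3 f = frechet_derivative (\<lambda>x. f (e3 + PL x)) (at 0)"

definition kappa_inv :: "real^3 \<Rightarrow> real^3 \<Rightarrow> real \<times> real \<Rightarrow> real^3" where
  "kappa_inv v w p = fst p *\<^sub>R v + snd p *\<^sub>R w"

definition kappa :: "real^3 \<Rightarrow> real^3 \<Rightarrow> real^3 \<Rightarrow> real \<times> real" where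
  "kappa v w x = (THE p. kappa_inv v w p = x)"

text \<open>The operator norm of \<^term>\<open>kappa v w\<close> on \<^term>\<open>Lspace\<close>; composing with the orthogonal
  projection does not change it.\<close>

definition kappa_norm :: "real^3 \<Rightarrow> real^3 \<Rightarrow> real" where
  "kappa_norm v w = onorm (\<lambda>x. kappa v w (PL x))"

definition Pmap :: "real^3 \<Rightarrow> real^3 \<Rightarrow> real^3 \<Rightarrow> real \<times> real" where
  "Pmap v w y = kappa v w (PL y)"

definition exterior_in_coordinates ::
    "(real^3 \<Rightarrow> real^3) \<Rightarrow> real \<Rightarrow> real^3 \<Rightarrow> real^3 \<Rightarrow> real \<times> real \<Rightarrow> real \<times> real" where
  "exterior_in_coordinates E r v w = Kinv E \<circ> E \<circ> inv_into (ME r) (Pmap v w)"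

definition admissible_alpha ::
    "(real^3 \<Rightarrow> real^3) \<Rightarrow> real \<Rightarrow> real^3 \<Rightarrow> real^3 \<Rightarrow> real \<Rightarrow> real \<Rightarrow> bool" where
  "admissible_alpha E r v w \<beta> \<alpha> \<longleftrightarrow> 0 < \<alpha> \<and> \<alpha> < pi \<and>
     (\<forall>p \<in> {-\<alpha>..\<alpha>} \<times> {-\<alpha>..\<alpha>}.
        p \<in> Pmap v w ` ME r \<and>
        norm (exterior_in_coordinates E r v w p - p) \<le> \<beta> * norm p \<and>
        onorm (\<lambda>q. frechet_derivative (exterior_in_coordinates E r v w) (at p) q - q) \<le> \<beta>)"

text \<open>The value at the transit time of the continuous angle along the projected trajectory.
  The value is unique, the angle function is so only on the interval up to the transit time.\<close>

definition angle_fun ::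
    "(real \<Rightarrow> real^3 \<Rightarrow> real^3) \<Rightarrow> (real^3 \<Rightarrow> real^3) \<Rightarrow> real \<times> real \<Rightarrow> real" where
  "angle_fun F E p = (let x = Kmap E p; \<tau> = transit_time F x in
     (THE a. \<exists>\<theta>. continuous_on {0..\<tau>} \<theta> \<and> \<theta> 0 = base_angle E + fst p \<and>
        (\<forall>t\<in>{0..\<tau>}. PL (F t x) /\<^sub>R norm (PL (F t x)) = vector [cos (\<theta> t), sin (\<theta> t), 0]) \<and>
        a = \<theta> \<tau>))"

definition M0 :: "(real \<times> real \<Rightarrow> real) \<Rightarrow> real \<Rightarrow> real \<Rightarrow> real \<Rightarrow> real \<Rightarrow> (real \<times> real) set" where
  "M0 \<Phi> \<alpha> \<Delta>1 \<Delta>2 \<psi> = {p \<in> {-\<alpha>..\<alpha>} \<times> {\<Delta>1..\<Delta>2}. \<psi> - pi < \<Phi> p \<and> \<Phi> p < \<psi>}"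

definition M1 :: "(real \<times> real \<Rightarrow> real) \<Rightarrow> real \<Rightarrow> real \<Rightarrow> real \<Rightarrow> real \<Rightarrow> (real \<times> real) set" where
  "M1 \<Phi> \<alpha> \<Delta>1 \<Delta>2 \<psi> = {p \<in> {-\<alpha>..\<alpha>} \<times> {\<Delta>1..\<Delta>2}. \<psi> < \<Phi> p \<and> \<Phi> p < \<psi> + pi}"


section \<open>Smallness conditions\<close>

definition m_dev :: "real \<Rightarrow> real \<Rightarrow> real" where
  "m_dev \<eta> \<sigma> = max (ln (1 + \<eta> * exp (-\<sigma>)))
     (max (ln (1 / (1 - \<eta> * exp (-\<sigma>)))) (arcsin (\<eta> / (exp \<sigma> - \<eta>))))"

text \<open>Here \<^term>\<open>\<epsilon>\<close> and \<^term>\<open>r\<close> are the members with index \<^term>\<open>j\<close> of the sequences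
  of scaling parameters and of radii.\<close>

definition smallness_conditions ::
    "real \<Rightarrow> real \<Rightarrow> (real \<Rightarrow> real) \<Rightarrow> real \<Rightarrow> real \<Rightarrow> real \<Rightarrow> real \<Rightarrow> real \<Rightarrow> real \<Rightarrow> real \<Rightarrow> bool" where
  "smallness_conditions \<sigma> u \<epsilon>\<eta> \<epsilon>B \<epsilon> r \<eta>' \<eta> \<delta>' \<delta> \<longleftrightarrow>
     0 < \<eta> \<and> \<eta> < exp \<sigma> / 2 \<and> 1 + \<eta> * exp (-\<sigma>) < exp (-\<sigma> / 2) \<and> m_dev \<eta> \<sigma> < \<eta>' \<and>
     \<epsilon> < min (\<epsilon>\<eta> \<eta>) \<epsilon>B \<and>
     0 < \<delta>' \<and> \<delta>' < 1 \<and> 1 + 2 / \<sigma> * ln r < 1 / (u + ln 2) * ln (1 / \<delta>') - 1 \<and>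
     0 < \<delta> \<and> \<delta> < \<delta>' \<and> 1 / (u + ln 2) * ln (1 / \<delta>) - 1 > m_dev \<eta> \<sigma> / (\<eta>' - m_dev \<eta> \<sigma>)"

end

theory Submission
  imports Defs "HOL-Complex_Analysis.Great_Picard"
begin

text \<open>Near the stationary point the scaled flow is close to the linear spiral saddle, so a point at height
  \<open>\<delta>\<close> reaches height \<open>1\<close> after a time of order \<open>ln (1 / \<delta>) / u\<close>, at a distance from the vertical axis
  which lies between two powers of \<open>\<delta>\<close>; the exterior map in coordinates is close to the identity.
  Hence the return map keeps the rectangle \<open>[-\<alpha>, \<alpha>] \<times> [\<Delta>1, \<Delta>2]\<close> within its width, sends points with
  angle \<open>\<psi>\<close> (the direction of \<open>w\<close>) above the rectangle and points with angle \<open>\<psi> - \<pi>\<close> or \<open>\<psi> + \<pi>\<close> below it.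
  Along a curve joining the horizontal edges of the rectangle the angle passes through \<open>[\<psi> - \<pi>, \<psi> + \<pi>]\<close>,
  so each of the two halves of this interval is covered by an arc whose image contains again a curve
  joining the horizontal edges. Induction realizes all finite itineraries, and compactness the
  bi-infinite ones; the boundary values of the angle are excluded since their images
  leave the rectangle.\<close>

section \<open>A horseshoe criterion in a rectangle\<close>

text \<open>Only continuity and size estimates of the return map and the angle are at hand, without
  monotonicity or hyperbolicity. Hence itineraries come from the intermediate value theorem along
  curves, and uniqueness of trajectories is not asserted. The passage near the stationary point can
  take arbitrarily long, so the deviation from the linear flow must be a relative one. Invariance of
  \<open>Lspace\<close> and \<open>Uspace\<close> supplies this: the mean value inequality between a
  point and its projection bounds the error in a component by a small multiple of that component. At
  the angles \<psi>, \<psi> - pi, \<psi> + pi the exit point is exactly a multiple of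
  \<open>w\<close>, with coordinates (0, b) in the first case and (0, -b) in the others. The lower
  radius bound at height \<Delta>1 and the choice of \<Delta>2 give b > 2 \<Delta>2, and the
  exterior map, with \<beta> at most 1/2, moves this point by at most b/2: the image height exceeds
  \<Delta>2, or is negative. As \<psi> - pi and \<psi> + pi both lead downwards, the two arcs are
  mapped with opposite orientations, so crossing curves carry no fixed direction.\<close>

lemma subinterval_between_values_up:
  fixes f :: "real \<Rightarrow> real"
  assumes cont: "continuous_on {a..b} f" and "a \<le> b" "u < v" "f a \<le> u" "v \<le> f b"
  obtains a' b' where "a \<le> a'" "a' \<le> b'" "b' \<le> b" "f a' = u" "f b' = v" "f ` {a'..b'} \<subseteq> {u..v}"
proof -
  have level: "compact {t \<in> {a..c}. f t = y}" if "c \<le> b" for c y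
  proof -
    have "continuous_on {a..c} f"
      using cont that by (auto intro: continuous_on_subset)
    then have "closed ({a..c} \<inter> f -` {y})"
      by (intro continuous_closed_preimage) auto
    moreover have "{a..c} \<inter> f -` {y} = {t \<in> {a..c}. f t = y}"
      by auto
    ultimately show ?thesis
      by (auto simp: compact_eq_bounded_closed intro: bounded_subset[of "{a..c}"])
  qed
  \<comment> \<open>The right end is the first time at which \<open>v\<close> is attained, the left
    end the last time before it at which \<open>u\<close> is attained. Leaving \<open>{u..v}\<close>
    in between would force another such time.\<close>
  have "\<exists>t\<ge>a. t \<le> b \<and> f t = v"
    using assms by (intro IVT') auto
  then have "{t \<in> {a..b}. f t = v} \<noteq> {}"
    by auto
  from compact_attains_inf[OF level[OF order_refl] this] obtain b'
    where b': "b' \<in> {a..b}" "f b' = v" and first: "\<And>t. t \<in> {a..b} \<Longrightarrow> f t = v \<Longrightarrow> b' \<le> t"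
    by blast
  have below: "f t \<le> v" if "t \<in> {a..b'}" for t
  proof (rule ccontr)
    assume "\<not> f t \<le> v"
    then have "\<exists>s\<ge>a. s \<le> t \<and> f s = v"
      using that b' assms by (intro IVT') (auto intro: continuous_on_subset)
    then obtain s where s: "a \<le> s" "s \<le> t" "f s = v" by auto
    then have "b' \<le> s" using first[of s] that b' by auto
    then have "t = b'" using s that by auto
    with \<open>\<not> f t \<le> v\<close> b' show False by auto
  qed
  have "\<exists>t\<ge>a. t \<le> b' \<and> f t = u"
    using assms b' by (intro IVT') (auto intro: continuous_on_subset)
  then have "{t \<in> {a..b'}. f t = u} \<noteq> {}"
    by auto
  moreover have "b' \<le> b" using b' by auto
  ultimately obtain a'
    where a': "a' \<in> {a..b'}" "f a' = u" and last: "\<And>t. t \<in> {a..b'} \<Longrightarrow> f t = u \<Longrightarrow> t \<le> a'"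
    using compact_attains_sup[OF level] by blast
  have above: "u \<le> f t" if "t \<in> {a'..b'}" for t
  proof (rule ccontr)
    assume "\<not> u \<le> f t"
    then have "\<exists>s\<ge>t. s \<le> b' \<and> f s = u"
      using that b' a' assms by (intro IVT') (auto intro: continuous_on_subset)
    then obtain s where s: "t \<le> s" "s \<le> b'" "f s = u" by auto
    then have "s \<le> a'" using last[of s] that a' by auto
    then have "t = a'" using s that by auto
    with \<open>\<not> u \<le> f t\<close> a' show False by auto
  qed
  show thesis
    using a' b' below above by (intro that[of a' b']) auto
qed

text \<open>The descending alternative is the ascending one for \<open>- f\<close>, with the levels
  \<open>- v\<close> and \<open>- u\<close>.\<close>

lemma subinterval_between_values:
  fixes f :: "real \<Rightarrow> real"
  assumes cont: "continuous_on {a..b} f" and "a \<le> b" "u < v"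
    and ends: "f a \<le> u \<and> v \<le> f b \<or> v \<le> f a \<and> f b \<le> u"
  obtains a' b' where "a \<le> a'" "a' \<le> b'" "b' \<le> b" "f ` {a'..b'} \<subseteq> {u..v}"
    "f a' = u \<and> f b' = v \<or> f a' = v \<and> f b' = u"
proof (cases "f a \<le> u \<and> v \<le> f b")
  case True
  then show thesis
    using subinterval_between_values_up[OF cont \<open>a \<le> b\<close> \<open>u < v\<close>] that by metis
next
  case False
  have "continuous_on {a..b} (\<lambda>t. - f t)"
    using cont by (intro continuous_intros)
  then obtain a' b' where *: "a \<le> a'" "a' \<le> b'" "b' \<le> b" "- f a' = - v" "- f b' = - u"
      "(\<lambda>t. - f t) ` {a'..b'} \<subseteq> {- v..- u}"
    using subinterval_between_values_up[of a b "\<lambda>t. - f t" "- v" "- u"] False ends \<open>a \<le> b\<close> \<open>u < v\<close>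
    by auto
  then show thesis
    by (intro that[of a' b']) (auto simp: image_subset_iff)
qed

text \<open>The disjunction in \<open>stretch\<close> stands outside the quantifier over points, so
  each symbol has one orientation on the whole rectangle, possibly different from that of another
  symbol. For crossing curves the weak inequalities suffice; strictness is what excludes the
  boundary angles in the end.\<close>

locale rectangle_horseshoe =
  fixes \<alpha> \<Delta>1 \<Delta>2 :: real and Q :: "real \<times> real \<Rightarrow> real \<times> real"
    and \<Phi> :: "real \<times> real \<Rightarrow> real" and lo hi :: "'s \<Rightarrow> real"
  assumes size: "0 \<le> \<alpha>" "\<Delta>1 < \<Delta>2"
    and cont_Q: "continuous_on ({-\<alpha>..\<alpha>} \<times> {\<Delta>1..\<Delta>2}) Q"
    and cont_\<Phi>: "continuous_on ({-\<alpha>..\<alpha>} \<times> {\<Delta>1..\<Delta>2}) \<Phi>"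
    and lo_hi: "lo i < hi i"
    and bottom: "x \<in> {-\<alpha>..\<alpha>} \<Longrightarrow> \<Phi> (x, \<Delta>1) \<le> lo i"
    and top: "x \<in> {-\<alpha>..\<alpha>} \<Longrightarrow> hi i \<le> \<Phi> (x, \<Delta>2)"
    and width: "p \<in> {-\<alpha>..\<alpha>} \<times> {\<Delta>1..\<Delta>2} \<Longrightarrow> fst (Q p) \<in> {-\<alpha>..\<alpha>}"
    and stretch: "(\<forall>p \<in> {-\<alpha>..\<alpha>} \<times> {\<Delta>1..\<Delta>2}.
          (\<Phi> p = lo i \<longrightarrow> snd (Q p) < \<Delta>1) \<and> (\<Phi> p = hi i \<longrightarrow> \<Delta>2 < snd (Q p)))
      \<or> (\<forall>p \<in> {-\<alpha>..\<alpha>} \<times> {\<Delta>1..\<Delta>2}.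
          (\<Phi> p = lo i \<longrightarrow> \<Delta>2 < snd (Q p)) \<and> (\<Phi> p = hi i \<longrightarrow> snd (Q p) < \<Delta>1))"
begin

abbreviation R where "R \<equiv> {-\<alpha>..\<alpha>} \<times> {\<Delta>1..\<Delta>2}"

definition strip where "strip i = {p \<in> R. lo i \<le> \<Phi> p \<and> \<Phi> p \<le> hi i}"

definition crossing :: "real \<Rightarrow> real \<Rightarrow> (real \<Rightarrow> real \<times> real) \<Rightarrow> bool" where
  "crossing a b \<gamma> \<longleftrightarrow> a \<le> b \<and> continuous_on {a..b} \<gamma> \<and> \<gamma> ` {a..b} \<subseteq> R \<and>
     (snd (\<gamma> a) = \<Delta>1 \<and> snd (\<gamma> b) = \<Delta>2 \<or> snd (\<gamma> a) = \<Delta>2 \<and> snd (\<gamma> b) = \<Delta>1)"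

text \<open>The curve is trimmed twice: first until the angle runs exactly between
  \<open>lo i\<close> and \<open>hi i\<close>, where \<open>stretch\<close> puts the image of the
  ends beyond opposite edges, then until the image height runs exactly between the edges.
  \<open>width\<close> keeps the image inside sideways.\<close>

lemma crossing_step:
  assumes "crossing a b \<gamma>"
  obtains a' b' where "a \<le> a'" "b' \<le> b" "\<gamma> ` {a'..b'} \<subseteq> strip i" "crossing a' b' (Q \<circ> \<gamma>)"
proof -
  from assms have "a \<le> b" and cont: "continuous_on {a..b} \<gamma>" and R: "\<And>t. t \<in> {a..b} \<Longrightarrow> \<gamma> t \<in> R"
    and ends: "snd (\<gamma> a) = \<Delta>1 \<and> snd (\<gamma> b) = \<Delta>2 \<or> snd (\<gamma> a) = \<Delta>2 \<and> snd (\<gamma> b) = \<Delta>1"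
    unfolding crossing_def by blast+
  have edge: "\<Phi> (\<gamma> t) \<le> lo i" if "t \<in> {a..b}" "snd (\<gamma> t) = \<Delta>1" for t
    using bottom[of "fst (\<gamma> t)" i] R[of t] that by (metis mem_Times_iff prod.collapse)
  have edge': "hi i \<le> \<Phi> (\<gamma> t)" if "t \<in> {a..b}" "snd (\<gamma> t) = \<Delta>2" for t
    using top[of "fst (\<gamma> t)" i] R[of t] that by (metis mem_Times_iff prod.collapse)
  have "continuous_on {a..b} (\<lambda>t. \<Phi> (\<gamma> t))"
    by (rule continuous_on_compose2[OF cont_\<Phi> cont]) (use R in blast)
  moreover have "\<Phi> (\<gamma> a) \<le> lo i \<and> hi i \<le> \<Phi> (\<gamma> b) \<or> hi i \<le> \<Phi> (\<gamma> a) \<and> \<Phi> (\<gamma> b) \<le> lo i"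
    using ends edge edge' \<open>a \<le> b\<close> by auto
  ultimately obtain a1 b1 where 1: "a \<le> a1" "a1 \<le> b1" "b1 \<le> b"
      "(\<lambda>t. \<Phi> (\<gamma> t)) ` {a1..b1} \<subseteq> {lo i..hi i}"
      "\<Phi> (\<gamma> a1) = lo i \<and> \<Phi> (\<gamma> b1) = hi i \<or> \<Phi> (\<gamma> a1) = hi i \<and> \<Phi> (\<gamma> b1) = lo i"
    using subinterval_between_values[of a b "\<lambda>t. \<Phi> (\<gamma> t)" "lo i" "hi i"] \<open>a \<le> b\<close> lo_hi[of i]
    by (metis (no_types, lifting))
  have Q\<gamma>: "continuous_on {a..b} (\<lambda>t. Q (\<gamma> t))"
    by (rule continuous_on_compose2[OF cont_Q cont]) (use R in blast)
  then have "continuous_on {a1..b1} (\<lambda>t. snd (Q (\<gamma> t)))"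
    using 1 by (intro continuous_intros) (auto intro: continuous_on_subset)
  moreover have "\<gamma> a1 \<in> R" "\<gamma> b1 \<in> R"
    using R 1 by auto
  then have "snd (Q (\<gamma> a1)) \<le> \<Delta>1 \<and> \<Delta>2 \<le> snd (Q (\<gamma> b1)) \<or>
      \<Delta>2 \<le> snd (Q (\<gamma> a1)) \<and> snd (Q (\<gamma> b1)) \<le> \<Delta>1"
    using stretch[of i] 1(5) by (meson less_imp_le)
  ultimately obtain a2 b2 where 2: "a1 \<le> a2" "a2 \<le> b2" "b2 \<le> b1"
      "(\<lambda>t. snd (Q (\<gamma> t))) ` {a2..b2} \<subseteq> {\<Delta>1..\<Delta>2}"
      "snd (Q (\<gamma> a2)) = \<Delta>1 \<and> snd (Q (\<gamma> b2)) = \<Delta>2 \<or> snd (Q (\<gamma> a2)) = \<Delta>2 \<and> snd (Q (\<gamma> b2)) = \<Delta>1"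
    using subinterval_between_values[of a1 b1 "\<lambda>t. snd (Q (\<gamma> t))" "\<Delta>1" "\<Delta>2"] size 1(2)
    by (metis (no_types, lifting))
  have in_ab: "t \<in> {a..b}" if "t \<in> {a2..b2}" for t
    using that 1 2 by auto
  have "\<gamma> ` {a2..b2} \<subseteq> strip i"
  proof
    fix p assume "p \<in> \<gamma> ` {a2..b2}"
    then obtain t where t: "t \<in> {a2..b2}" "p = \<gamma> t" by auto
    then have "t \<in> {a1..b1}" using 2 by auto
    then have "\<Phi> (\<gamma> t) \<in> {lo i..hi i}" using 1(4) by blast
    then show "p \<in> strip i" using t R[OF in_ab[OF t(1)]] by (simp add: strip_def)
  qed
  moreover have "crossing a2 b2 (Q \<circ> \<gamma>)"
    unfolding crossing_def
  proof (intro conjI)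
    show "continuous_on {a2..b2} (Q \<circ> \<gamma>)"
      using Q\<gamma> in_ab by (auto simp: o_def intro: continuous_on_subset)
    show "(Q \<circ> \<gamma>) ` {a2..b2} \<subseteq> R"
    proof
      fix p assume "p \<in> (Q \<circ> \<gamma>) ` {a2..b2}"
      then obtain t where t: "t \<in> {a2..b2}" "p = Q (\<gamma> t)" by auto
      then have "snd p \<in> {\<Delta>1..\<Delta>2}" "fst p \<in> {-\<alpha>..\<alpha>}"
        using 2(4) width[OF R[OF in_ab[OF t(1)]]] by blast+
      then show "p \<in> R" by (simp add: mem_Times_iff)
    qed
  qed (use 2 in auto)
  ultimately show thesis
    using 1 2 by (intro that[of a2 b2]) auto
qed

text \<open>The induction hypothesis is applied to the image of the trimmed curve, with the symbols
  shifted by one. Trimming keeps the parametrization, so a parameter found for the image serves the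
  original curve as well.\<close>

lemma finite_itinerary:
  assumes "crossing a b \<gamma>"
  shows "\<exists>t\<in>{a..b}. \<forall>i<n. (Q ^^ i) (\<gamma> t) \<in> strip (s i)"
  using assms
proof (induction n arbitrary: a b \<gamma> s)
  case 0
  then show ?case by (auto simp: crossing_def)
next
  case (Suc n)
  obtain a' b' where *: "a \<le> a'" "b' \<le> b" "\<gamma> ` {a'..b'} \<subseteq> strip (s 0)" "crossing a' b' (Q \<circ> \<gamma>)"
    using crossing_step[OF Suc.prems] by metis
  obtain t where t: "t \<in> {a'..b'}" "\<forall>i<n. (Q ^^ i) ((Q \<circ> \<gamma>) t) \<in> strip (s (Suc i))"
    using Suc.IH[OF *(4), of "\<lambda>i. s (Suc i)"] by auto
  have "(Q ^^ i) (\<gamma> t) \<in> strip (s i)" if "i < Suc n" for i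
  proof (cases i)
    case 0
    then show ?thesis using * t by auto
  next
    case (Suc i')
    then show ?thesis using t that by (simp add: funpow_swap1)
  qed
  with * t show ?case by (intro bexI[of _ t]) auto
qed

lemma finite_itinerary_point: "\<exists>p. \<forall>i<n. (Q ^^ i) p \<in> strip (s i)"
proof -
  have "crossing \<Delta>1 \<Delta>2 (\<lambda>t. (0, t))"
    using size by (auto simp: crossing_def intro!: continuous_intros)
  from finite_itinerary[OF this] show ?thesis by blast
qed

lemma closed_strip: "closed (strip i)"
proof -
  have "closed (R \<inter> \<Phi> -` {lo i..hi i})"
    using cont_\<Phi> by (intro continuous_closed_preimage closed_Times) auto
  moreover have "R \<inter> \<Phi> -` {lo i..hi i} = strip i"
    by (auto simp: strip_def)
  ultimately show ?thesis by simp
qed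

text \<open>Finite orbits are shifted in time to be centred at 0, and a subsequence converges at
  every integer. Closed strips and continuity of \<open>Q\<close> on the rectangle carry itinerary
  and orbit relation over to the limit, at first with weak inequalities for the angle.\<close>

lemma all_itineraries_realized:
  fixes s :: "int \<Rightarrow> 's"
  obtains y :: "int \<Rightarrow> real \<times> real" where
    "\<And>n. y (n + 1) = Q (y n)" "\<And>n. y n \<in> R" "\<And>n. lo (s n) < \<Phi> (y n)" "\<And>n. \<Phi> (y n) < hi (s n)"
proof -
  \<comment> \<open>The point for \<open>N\<close> is placed at time -N: its iterate
    \<open>i\<close> has to carry the symbol of time i - N.\<close>
  have "\<forall>N. \<exists>p. \<forall>i<2 * N + 2. (Q ^^ i) p \<in> strip (s (int i - int N))"
    by (intro allI finite_itinerary_point)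
  then obtain p where p: "\<And>N i. i < 2 * N + 2 \<Longrightarrow> (Q ^^ i) (p N) \<in> strip (s (int i - int N))"
    by metis
  \<comment> \<open>The filler 0 outside the window makes every orbit a bounded function on all
    integers, as the selection of a subsequence requires; this is also why the bound below is
    \<open>max M 0\<close>.\<close>
  define y where "y N n = (if \<bar>n\<bar> \<le> int N then (Q ^^ nat (n + int N)) (p N) else 0)" for N n
  have y_strip: "y N n \<in> strip (s n)" if "\<bar>n\<bar> \<le> int N" for N n
  proof -
    have "nat (n + int N) < 2 * N + 2" "int (nat (n + int N)) - int N = n"
      using that by auto
    then show ?thesis
      using p[of "nat (n + int N)" N] that by (simp add: y_def)
  qed
  have y_step: "y N (n + 1) = Q (y N n)" if "\<bar>n\<bar> \<le> int N" "\<bar>n + 1\<bar> \<le> int N" for N n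
  proof -
    have "nat (n + 1 + int N) = Suc (nat (n + int N))"
      using that by auto
    then show ?thesis
      using that by (simp add: y_def)
  qed
  have "bounded R" by (intro bounded_Times) auto
  then obtain M where M: "\<And>q. q \<in> R \<Longrightarrow> norm q \<le> M"
    by (auto simp: bounded_iff)
  have y_bound: "norm (y N n) \<le> max M 0" for N n
  proof (cases "\<bar>n\<bar> \<le> int N")
    case True
    then have "y N n \<in> R" using y_strip by (auto simp: strip_def)
    then show ?thesis using M by (simp add: le_max_iff_disj)
  qed (simp add: y_def)
  \<comment> \<open>Diagonal selection over the countable set of times: one subsequence converges at
    all of them.\<close>
  obtain k where k: "strict_mono k" and "\<And>n. n \<in> UNIV \<Longrightarrow> \<exists>l. (\<lambda>N. y (k N) n) \<longlonglongrightarrow> l"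
    by (rule function_convergent_subsequence[of "UNIV :: int set" y "max M 0"])
      (use y_bound in \<open>assumption | rule countableI_type | blast\<close>)+
  then obtain l where l: "\<And>n. (\<lambda>N. y (k N) n) \<longlonglongrightarrow> l n"
    by (metis UNIV_I)
  have ev: "\<forall>\<^sub>F N in sequentially. \<bar>n\<bar> \<le> int (k N)" for n
  proof -
    have "\<forall>\<^sub>F N in sequentially. nat \<bar>n\<bar> \<le> N" by (rule eventually_ge_at_top)
    then show ?thesis
    proof eventually_elim
      case (elim N)
      then have "nat \<bar>n\<bar> \<le> k N" using seq_suble[OF k, of N] by linarith
      then show ?case by linarith
    qed
  qed
  have l_strip: "l n \<in> strip (s n)" for n
  proof (rule Lim_in_closed_set[OF closed_strip _ _ l])
    show "\<forall>\<^sub>F N in sequentially. y (k N) n \<in> strip (s n)"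
      using ev[of n] by eventually_elim (rule y_strip)
  qed auto
  then have l_R: "l n \<in> R" for n
    by (auto simp: strip_def)
  have l_step: "l (n + 1) = Q (l n)" for n
  proof -
    have "(\<lambda>N. Q (y (k N) n)) \<longlonglongrightarrow> Q (l n)"
    proof (rule continuous_on_tendsto_compose[OF cont_Q l l_R])
      show "\<forall>\<^sub>F N in sequentially. y (k N) n \<in> R"
        using ev[of n] by eventually_elim (use y_strip in \<open>auto simp: strip_def\<close>)
    qed
    moreover have "\<forall>\<^sub>F N in sequentially. Q (y (k N) n) = y (k N) (n + 1)"
      using ev[of n] ev[of "n + 1"] by eventually_elim (simp add: y_step)
    ultimately have "(\<lambda>N. y (k N) (n + 1)) \<longlonglongrightarrow> Q (l n)"
      by (rule Lim_transform_eventually)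
    with l[of "n + 1"] show ?thesis
      by (rule LIMSEQ_unique)
  qed
  \<comment> \<open>The next point of the limit orbit lies in the rectangle, whereas
    \<open>stretch\<close> would move a point with a boundary angle strictly out of it.\<close>
  have "snd (Q (l n)) \<in> {\<Delta>1..\<Delta>2}" for n
    using l_R[of "n + 1"] by (simp add: l_step mem_Times_iff)
  then have "\<Phi> (l n) \<noteq> lo (s n) \<and> \<Phi> (l n) \<noteq> hi (s n)" for n
    using stretch[of "s n"] l_R[of n] by (metis atLeastAtMost_iff not_less)
  moreover have "lo (s n) \<le> \<Phi> (l n) \<and> \<Phi> (l n) \<le> hi (s n)" for n
    using l_strip[of n] by (simp add: strip_def)
  ultimately show thesis
    using l_step l_R by (intro that[of l]) (metis order_less_le)+
qed

end

section \<open>Flows close to a linear saddle\<close>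

lemma PL_nth [simp]: "PL x $ 1 = x $ 1" "PL x $ 2 = x $ 2" "PL x $ 3 = 0"
  by (simp_all add: PL_def axis_def)

lemma PU_nth [simp]: "PU x $ 1 = 0" "PU x $ 2 = 0" "PU x $ 3 = x $ 3"
  by (simp_all add: PU_def axis_def)

lemma norm_PU [simp]: "norm (PU x) = \<bar>x $ 3\<bar>"
  by (simp add: norm_vec_def L2_set_def sum_3)

lemma linear_PL: "linear PL"
  by (intro linearI) (simp_all add: vec_eq_iff forall_3)

lemma bounded_linear_PL: "bounded_linear PL"
  by (rule linear_conv_bounded_linear[THEN iffD1, OF linear_PL])

lemma continuous_on_PL [continuous_intros]:
  "continuous_on S f \<Longrightarrow> continuous_on S (\<lambda>x. PL (f x))"
  by (rule bounded_linear.continuous_on[OF bounded_linear_PL])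

lemma norm_PL_le: "norm (PL x) \<le> norm x"
  by (simp add: norm_vec_def L2_set_def sum_3)

lemma Lspace_iff: "x \<in> Lspace \<longleftrightarrow> x $ 3 = 0"
proof
  show "x $ 3 = 0" if "x \<in> Lspace"
    using that unfolding Lspace_def
    by (induction rule: span_induct_alt) (auto simp: axis_def)
next
  assume "x $ 3 = 0"
  then have "x = (x $ 1) *\<^sub>R axis 1 1 + (x $ 2) *\<^sub>R axis 2 1"
    by (simp add: vec_eq_iff forall_3 axis_def)
  then show "x \<in> Lspace"
    unfolding Lspace_def by (metis insert_iff span_add span_base span_scale)
qed

lemma Uspace_iff: "x \<in> Uspace \<longleftrightarrow> x $ 1 = 0 \<and> x $ 2 = 0"
proof
  show "x $ 1 = 0 \<and> x $ 2 = 0" if "x \<in> Uspace"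
    using that unfolding Uspace_def
    by (induction rule: span_induct_alt) (auto simp: axis_def)
next
  assume "x $ 1 = 0 \<and> x $ 2 = 0"
  then have "x = (x $ 3) *\<^sub>R axis 3 1"
    by (simp add: vec_eq_iff forall_3 axis_def)
  then show "x \<in> Uspace"
    unfolding Uspace_def by (metis insertI1 span_base span_scale)
qed

text \<open>\<open>q = \<eta> exp (- \<sigma>)\<close> bounds the relative deviation from the linear flow over at most one time
  unit, so an orbit segment of length \<open>t\<close> in \<^const>\<open>B1\<close> deviates by at most \<open>t + 1\<close> such factors.\<close>

locale near_linear_flow =
  fixes G :: "real \<Rightarrow> real^3 \<Rightarrow> real^3" and \<sigma> u q :: real
  assumes flow: "is_flow G"
    and cont: "continuous_on UNIV (\<lambda>(t, x). G t x)"
    and rates: "\<sigma> < 0" "0 < \<sigma> + u"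
    and q: "0 < q" "q < 1 / 2" "1 + q < exp (- \<sigma> / 2)"
    and vertical: "x \<in> B1 \<Longrightarrow> t \<in> {0..1} \<Longrightarrow> \<bar>G t x $ 3 - exp (u * t) * x $ 3\<bar> \<le> q * exp \<sigma> * \<bar>x $ 3\<bar>"
    and horizontal: "x \<in> B1 \<Longrightarrow> t \<in> {0..1} \<Longrightarrow>
      \<bar>norm (PL (G t x)) - exp (\<sigma> * t) * norm (PL x)\<bar> \<le> q * exp \<sigma> * norm (PL x)"
begin

lemma flow_0 [simp]: "G 0 x = x" and flow_add: "G (s + t) x = G s (G t x)"
  using flow unfolding is_flow_def by (metis add.commute)+

lemma continuous_flow:
  assumes "continuous_on S f" "continuous_on S g"
  shows "continuous_on S (\<lambda>x. G (f x) (g x))"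
proof -
  have "continuous_on S (\<lambda>x. (\<lambda>(t, y). G t y) (f x, g x))"
    using assms by (intro continuous_on_compose2[OF cont]) (auto intro!: continuous_intros)
  then show ?thesis by simp
qed

lemma continuous_height: "continuous_on S (\<lambda>t. G t x $ 3)"
  by (intro continuous_intros continuous_flow)

text \<open>The number \<open>exp \<sigma>\<close> is the smallest of all factors
  \<open>exp (\<sigma> * t)\<close> and \<open>exp (u * t)\<close> with t in [0, 1]. An error of
  \<open>q * exp \<sigma>\<close> therefore costs at most a factor 1 - q or 1 + q, here and for the
  radius.\<close>

lemma step_height:
  assumes "x \<in> B1" "0 < x $ 3" "t \<in> {0..1}"
  shows "exp (u * t) * (1 - q) * x $ 3 \<le> G t x $ 3" "G t x $ 3 \<le> exp (u * t) * (1 + q) * x $ 3"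
proof -
  have "exp \<sigma> \<le> exp (u * t)"
    using rates assms(3) by (auto intro: order_trans[of _ 0])
  then have "q * exp \<sigma> * x $ 3 \<le> q * exp (u * t) * x $ 3"
    using q assms(2) by simp
  then show "exp (u * t) * (1 - q) * x $ 3 \<le> G t x $ 3" "G t x $ 3 \<le> exp (u * t) * (1 + q) * x $ 3"
    using vertical[OF assms(1,3)] assms(2) by (auto simp: algebra_simps abs_le_iff)
qed

lemma step_radius:
  assumes "x \<in> B1" "t \<in> {0..1}"
  shows "exp (\<sigma> * t) * (1 - q) * norm (PL x) \<le> norm (PL (G t x))"
    "norm (PL (G t x)) \<le> exp (\<sigma> * t) * (1 + q) * norm (PL x)"
proof -
  have "exp \<sigma> \<le> exp (\<sigma> * t)"
    using rates assms(2) by (simp add: mult_le_cancel_left1)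
  then have "q * exp \<sigma> * norm (PL x) \<le> q * exp (\<sigma> * t) * norm (PL x)"
    using q by (intro mult_right_mono mult_left_mono) auto
  then show "exp (\<sigma> * t) * (1 - q) * norm (PL x) \<le> norm (PL (G t x))"
    "norm (PL (G t x)) \<le> exp (\<sigma> * t) * (1 + q) * norm (PL x)"
    using horizontal[OF assms] by (auto simp: algebra_simps abs_le_iff)
qed

text \<open>Each unit step contributes one factor 1 - q or 1 + q. The cruder last bound, from 1 + q
  < exp (- \<sigma> / 2), shows that the radius does not grow; with the assumed height bound this
  keeps the orbit in \<open>B1\<close>, so that the next step can be estimated.\<close>

lemma iterate_bounds:
  assumes x: "x \<in> B1" "0 < x $ 3" and low: "\<And>i. i \<le> n \<Longrightarrow> G (real i) x $ 3 \<le> 1"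
  shows "G (real n) x \<in> B1 \<and> 0 < G (real n) x $ 3
    \<and> exp (u * n) * (1 - q) ^ n * x $ 3 \<le> G (real n) x $ 3
    \<and> G (real n) x $ 3 \<le> exp (u * n) * (1 + q) ^ n * x $ 3
    \<and> exp (\<sigma> * n) * (1 - q) ^ n * norm (PL x) \<le> norm (PL (G (real n) x))
    \<and> norm (PL (G (real n) x)) \<le> exp (\<sigma> * n) * (1 + q) ^ n * norm (PL x)
    \<and> norm (PL (G (real n) x)) \<le> exp (\<sigma> * n / 2) * norm (PL x)"
  using low
proof (induction n)
  case 0
  then show ?case using x by simp
next
  case (Suc n)
  define y where "y = G (real n) x"
  from Suc have y: "y \<in> B1" "0 < y $ 3"
    "exp (u * n) * (1 - q) ^ n * x $ 3 \<le> y $ 3"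
    "y $ 3 \<le> exp (u * n) * (1 + q) ^ n * x $ 3"
    "exp (\<sigma> * n) * (1 - q) ^ n * norm (PL x) \<le> norm (PL y)"
    "norm (PL y) \<le> exp (\<sigma> * n) * (1 + q) ^ n * norm (PL x)"
    "norm (PL y) \<le> exp (\<sigma> * n / 2) * norm (PL x)"
    unfolding y_def by auto
  have S: "G (real (Suc n)) x = G 1 y"
    unfolding y_def flow_add[symmetric] by (simp add: add.commute)
  have one: "(1::real) \<in> {0..1}" by simp
  note step = step_height[OF y(1,2) one] step_radius[OF y(1) one]
  have pos: "0 < exp (u * 1) * (1 - q)" "0 < exp (u * 1) * (1 + q)"
    "0 < exp (\<sigma> * 1) * (1 - q)" "0 < exp (\<sigma> * 1) * (1 + q)"
    using q by auto
  have e: "exp (a * real (Suc n)) = exp a * exp (a * n)" for a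
    by (simp add: algebra_simps exp_add)
  have 1: "exp (u * Suc n) * (1 - q) ^ Suc n * x $ 3 \<le> G 1 y $ 3"
    using order_trans[OF mult_left_mono[OF y(3) less_imp_le[OF pos(1)]] step(1)]
    unfolding e by (simp add: mult_ac)
  have 2: "G 1 y $ 3 \<le> exp (u * Suc n) * (1 + q) ^ Suc n * x $ 3"
    using order_trans[OF step(2) mult_left_mono[OF y(4) less_imp_le[OF pos(2)]]]
    unfolding e by (simp add: mult_ac)
  have 3: "exp (\<sigma> * Suc n) * (1 - q) ^ Suc n * norm (PL x) \<le> norm (PL (G 1 y))"
    using order_trans[OF mult_left_mono[OF y(5) less_imp_le[OF pos(3)]] step(3)]
    unfolding e by (simp add: mult_ac)
  have 4: "norm (PL (G 1 y)) \<le> exp (\<sigma> * Suc n) * (1 + q) ^ Suc n * norm (PL x)"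
    using order_trans[OF step(4) mult_left_mono[OF y(6) less_imp_le[OF pos(4)]]]
    unfolding e by (simp add: mult_ac)
  have "exp \<sigma> * (1 + q) \<le> exp \<sigma> * exp (- \<sigma> / 2)"
    using q by simp
  also have "\<dots> = exp (\<sigma> / 2)"
    by (simp flip: exp_add)
  finally have half: "exp \<sigma> * (1 + q) \<le> exp (\<sigma> / 2)" .
  have "norm (PL (G 1 y)) \<le> exp (\<sigma> / 2) * norm (PL y)"
    using step(4) mult_right_mono[OF half, of "norm (PL y)"] by simp
  also have "\<dots> \<le> exp (\<sigma> / 2) * (exp (\<sigma> * n / 2) * norm (PL x))"
    using y(7) by simp
  also have "\<dots> = exp (\<sigma> * Suc n / 2) * norm (PL x)"
    by (simp add: algebra_simps add_divide_distrib exp_add)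
  finally have 5: "norm (PL (G 1 y)) \<le> exp (\<sigma> * Suc n / 2) * norm (PL x)" .
  have "0 < exp (u * 1) * (1 - q) * y $ 3"
    using pos(1) y(2) by (rule mult_pos_pos)
  then have 6: "0 < G 1 y $ 3"
    using step(1) by simp
  have "exp (\<sigma> * Suc n / 2) \<le> 1"
    using rates by (simp add: mult_nonpos_nonneg)
  then have "exp (\<sigma> * Suc n / 2) * norm (PL x) \<le> 1 * 1"
    using x(1) by (intro mult_mono) (auto simp: B1_def)
  then have "norm (PL (G 1 y)) \<le> 1" using 5 by simp
  moreover have "G 1 y $ 3 \<le> 1" using Suc.prems[of "Suc n"] unfolding S by simp
  ultimately have "G 1 y \<in> B1" using 6 by (simp add: B1_def)
  with 1 2 3 4 5 6 show ?case unfolding S by blast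
qed

lemma orbit_bounds:
  assumes x: "x \<in> B1" "0 < x $ 3" and t: "0 \<le> t" and low: "\<And>s. 0 \<le> s \<Longrightarrow> s < t \<Longrightarrow> G s x $ 3 \<le> 1"
  shows "0 < G t x $ 3"
    "\<exists>n. real n \<le> t \<and> exp (u * t) * (1 - q) ^ Suc n * x $ 3 \<le> G t x $ 3
    \<and> G t x $ 3 \<le> exp (u * t) * (1 + q) ^ Suc n * x $ 3
    \<and> exp (\<sigma> * t) * (1 - q) ^ Suc n * norm (PL x) \<le> norm (PL (G t x))
    \<and> norm (PL (G t x)) \<le> exp (\<sigma> * t) * (1 + q) ^ Suc n * norm (PL x)
    \<and> norm (PL (G t x)) \<le> exp (\<sigma> * (t - 1) / 2) * norm (PL x)"
proof -
  obtain n s where n: "t = s + real n" "0 \<le> s" "s \<le> 1" and low_n: "\<And>i. i \<le> n \<Longrightarrow> G (real i) x $ 3 \<le> 1"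
  proof (cases "t = 0")
    case True
    then show thesis using x that[of 0 0] by (simp add: B1_def)
  next
    case False
    \<comment> \<open>The floor would not do: heights are bounded only strictly before
      \<open>t\<close>, so n < t is needed even if \<open>t\<close> is an integer. The last step
      then has length at most 1.\<close>
    define n where "n = nat (\<lceil>t\<rceil> - 1)"
    have "real n = of_int \<lceil>t\<rceil> - 1"
      using False t by (simp add: n_def)
    then have "real n < t" "t \<le> real n + 1" by linarith+
    then show thesis using low by (intro that[of "t - real n" n]) auto
  qed
  define y where "y = G (real n) x"
  from iterate_bounds[OF x low_n] have y: "y \<in> B1" "0 < y $ 3"
    "exp (u * n) * (1 - q) ^ n * x $ 3 \<le> y $ 3"
    "y $ 3 \<le> exp (u * n) * (1 + q) ^ n * x $ 3"
    "exp (\<sigma> * n) * (1 - q) ^ n * norm (PL x) \<le> norm (PL y)"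
    "norm (PL y) \<le> exp (\<sigma> * n) * (1 + q) ^ n * norm (PL x)"
    "norm (PL y) \<le> exp (\<sigma> * n / 2) * norm (PL x)"
    unfolding y_def by auto
  have S: "G t x = G s y"
    unfolding y_def flow_add[symmetric] n(1) ..
  have s: "s \<in> {0..1}" using n by simp
  note step = step_height[OF y(1,2) s] step_radius[OF y(1) s]
  have pos: "0 < exp (u * s) * (1 - q)" "0 < exp (u * s) * (1 + q)"
    "0 < exp (\<sigma> * s) * (1 - q)" "0 < exp (\<sigma> * s) * (1 + q)"
    using q by auto
  have e: "exp (a * t) = exp (a * s) * exp (a * n)" for a
    by (simp add: n(1) algebra_simps exp_add)
  have 1: "exp (u * t) * (1 - q) ^ Suc n * x $ 3 \<le> G t x $ 3"
    using order_trans[OF mult_left_mono[OF y(3) less_imp_le[OF pos(1)]] step(1)]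
    unfolding e S by (simp add: mult_ac)
  have 2: "G t x $ 3 \<le> exp (u * t) * (1 + q) ^ Suc n * x $ 3"
    using order_trans[OF step(2) mult_left_mono[OF y(4) less_imp_le[OF pos(2)]]]
    unfolding e S by (simp add: mult_ac)
  have 3: "exp (\<sigma> * t) * (1 - q) ^ Suc n * norm (PL x) \<le> norm (PL (G t x))"
    using order_trans[OF mult_left_mono[OF y(5) less_imp_le[OF pos(3)]] step(3)]
    unfolding e S by (simp add: mult_ac)
  have 4: "norm (PL (G t x)) \<le> exp (\<sigma> * t) * (1 + q) ^ Suc n * norm (PL x)"
    using order_trans[OF step(4) mult_left_mono[OF y(6) less_imp_le[OF pos(4)]]]
    unfolding e S by (simp add: mult_ac)
  \<comment> \<open>The incomplete step pays a full factor 1 + q but contracts only during time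
    \<open>s\<close>. The loss \<open>exp (- \<sigma> / 2)\<close> is the origin of t - 1 in the
    crude radius bound.\<close>
  have "exp (\<sigma> * s) * (1 + q) \<le> exp (\<sigma> * s) * exp (- \<sigma> / 2)"
    using q by simp
  also have "\<dots> = exp (\<sigma> * s - \<sigma> / 2)"
    by (simp flip: exp_add)
  also have "\<dots> \<le> exp (\<sigma> * (s - 1) / 2)"
    using rates n(2) by (simp add: field_simps mult_le_0_iff)
  finally have half: "exp (\<sigma> * s) * (1 + q) \<le> exp (\<sigma> * (s - 1) / 2)" .
  have "norm (PL (G t x)) \<le> exp (\<sigma> * (s - 1) / 2) * norm (PL y)"
    using step(4) mult_right_mono[OF half, of "norm (PL y)"] unfolding S by simp
  also have "\<dots> \<le> exp (\<sigma> * (s - 1) / 2) * (exp (\<sigma> * n / 2) * norm (PL x))"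
    using y(7) by simp
  also have "\<dots> = exp (\<sigma> * (t - 1) / 2) * norm (PL x)"
    by (simp add: n(1) mult_exp_exp field_simps)
  finally have 5: "norm (PL (G t x)) \<le> exp (\<sigma> * (t - 1) / 2) * norm (PL x)" .
  show "0 < G t x $ 3"
    using step(1) mult_pos_pos[OF pos(1) y(2)] unfolding S by simp
  show "\<exists>n. real n \<le> t \<and> exp (u * t) * (1 - q) ^ Suc n * x $ 3 \<le> G t x $ 3
    \<and> G t x $ 3 \<le> exp (u * t) * (1 + q) ^ Suc n * x $ 3
    \<and> exp (\<sigma> * t) * (1 - q) ^ Suc n * norm (PL x) \<le> norm (PL (G t x))
    \<and> norm (PL (G t x)) \<le> exp (\<sigma> * t) * (1 + q) ^ Suc n * norm (PL x)
    \<and> norm (PL (G t x)) \<le> exp (\<sigma> * (t - 1) / 2) * norm (PL x)"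
    using 1 2 3 4 5 n by (intro exI[of _ n]) auto
qed

text \<open>From \<sigma> + u > 0 and the third condition on \<open>q\<close> one has (1 + q)^2
  \<le> exp u, and (1 + q)^2 (1 - q) = 1 + q - q^2 - q^3 exceeds 1 for q < 1/2. Hence heights grow
  geometrically even with the worst error.\<close>

lemma vertical_growth: "1 < exp u * (1 - q)"
proof -
  have "exp (- \<sigma> / 2) * exp (- \<sigma> / 2) = exp (- \<sigma>)"
    by (simp flip: exp_add)
  moreover have "exp (- \<sigma>) \<le> exp u" using rates by simp
  moreover have "(1 + q) * (1 + q) \<le> exp (- \<sigma> / 2) * exp (- \<sigma> / 2)"
    using q by (intro mult_mono) auto
  ultimately have *: "(1 + q) * (1 + q) \<le> exp u" by linarith
  have "q * (q + q * q) < q * 1"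
  proof (rule mult_strict_left_mono)
    have "q * q \<le> 1 / 2 * (1 / 2)" using q by (intro mult_mono) auto
    then show "q + q * q < 1" using q by simp
  qed (use q in simp)
  then have "1 < (1 + q) * (1 + q) * (1 - q)"
    by (simp add: algebra_simps)
  also have "\<dots> \<le> exp u * (1 - q)"
    using * q by (intro mult_right_mono) auto
  finally show ?thesis .
qed

definition is_transit :: "real^3 \<Rightarrow> real \<Rightarrow> bool" where
  "is_transit x t \<longleftrightarrow> 0 < t \<and> (\<forall>s\<in>{0..<t}. 0 < G s x $ 3 \<and> G s x $ 3 < 1) \<and> G t x $ 3 = 1"

lemma is_transit_unique: "is_transit x s \<Longrightarrow> is_transit x t \<Longrightarrow> s = t"
  proof (induction s t rule: linorder_wlog)
  case (le s t)
  then show ?case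
    unfolding is_transit_def by (metis atLeastLessThan_iff less_eq_real_def less_irrefl)
qed auto

text \<open>Geometric growth at integer times contradicts staying below height 1; the transit time
  is the first time at height 1, which exists by compactness.\<close>

lemma ex_transit:
  assumes x: "x \<in> B1" "0 < x $ 3" "x $ 3 < 1"
  shows "\<exists>t. is_transit x t"
proof -
  have "\<exists>t\<ge>0. 1 \<le> G t x $ 3"
  proof (rule ccontr)
    assume "\<not> (\<exists>t\<ge>0. 1 \<le> G t x $ 3)"
    then have low: "G (real i) x $ 3 \<le> 1" for i
      by (meson linear of_nat_0_le_iff)
    obtain n where n: "1 / x $ 3 < (exp u * (1 - q)) ^ n"
      using vertical_growth real_arch_pow by blast
    have "(exp u * (1 - q)) ^ n * x $ 3 \<le> G (real n) x $ 3"
      using iterate_bounds[OF x(1,2) low, of n]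
      by (simp add: power_mult_distrib flip: exp_of_nat2_mult)
    moreover have "1 < (exp u * (1 - q)) ^ n * x $ 3"
      using n x(2) by (simp add: pos_divide_less_eq)
    ultimately show False using low[of n] by simp
  qed
  then obtain T where T: "0 \<le> T" "1 \<le> G T x $ 3" by auto
  have "\<exists>t\<ge>0. t \<le> T \<and> G t x $ 3 = 1"
    using T x continuous_height by (intro IVT') auto
  then have ne: "{0..T} \<inter> (\<lambda>t. G t x $ 3) -` {1} \<noteq> {}" by auto
  have "closed ({0..T} \<inter> (\<lambda>t. G t x $ 3) -` {1})"
    by (intro continuous_closed_preimage continuous_height) auto
  then have "compact ({0..T} \<inter> (\<lambda>t. G t x $ 3) -` {1})"
    by (auto simp: compact_eq_bounded_closed intro: bounded_subset[of "{0..T}"])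
  from compact_attains_inf[OF this ne] obtain t
    where t: "t \<in> {0..T}" "G t x $ 3 = 1" and first: "\<And>s. s \<in> {0..T} \<Longrightarrow> G s x $ 3 = 1 \<Longrightarrow> t \<le> s"
    by blast
  have below: "G s x $ 3 < 1" if "s \<in> {0..<t}" for s
  proof (rule ccontr)
    assume "\<not> G s x $ 3 < 1"
    then have "\<exists>s'\<ge>0. s' \<le> s \<and> G s' x $ 3 = 1"
      using that x continuous_height by (intro IVT') auto
    then show False using first that t by force
  qed
  have "0 < G s x $ 3" if "s \<in> {0..<t}" for s
    using that below by (intro orbit_bounds(1)[OF x(1,2)]) (auto intro: less_imp_le)
  moreover have "0 < t" using t x by (cases "t = 0") auto
  ultimately show ?thesis using below t unfolding is_transit_def by blast
qed

abbreviation "\<tau> \<equiv> transit_time G"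

lemma is_transit_transit_time:
  assumes "x \<in> B1" "0 < x $ 3" "x $ 3 < 1"
  shows "is_transit x (\<tau> x)"
proof -
  have "\<exists>!t. is_transit x t"
    using ex_transit[OF assms] is_transit_unique by blast
  from theI'[OF this] show ?thesis
    unfolding transit_time_def is_transit_def .
qed

lemma transit_bounds:
  assumes x: "x \<in> B1" "0 < x $ 3" "x $ 3 < 1" and t: "t = \<tau> x"
  shows "\<exists>n. real n \<le> t \<and> exp (u * t) * (1 - q) ^ Suc n * x $ 3 \<le> 1
    \<and> 1 \<le> exp (u * t) * (1 + q) ^ Suc n * x $ 3
    \<and> exp (\<sigma> * t) * (1 - q) ^ Suc n * norm (PL x) \<le> norm (PL (G t x))
    \<and> norm (PL (G t x)) \<le> exp (\<sigma> * t) * (1 + q) ^ Suc n * norm (PL x)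
    \<and> norm (PL (G t x)) \<le> exp (\<sigma> * (t - 1) / 2) * norm (PL x)"
proof -
  have "is_transit x t" using is_transit_transit_time[OF x(1-3)] t by simp
  then have "0 \<le> t" "\<And>s. 0 \<le> s \<Longrightarrow> s < t \<Longrightarrow> G s x $ 3 \<le> 1" "G t x $ 3 = 1"
    by (auto simp: is_transit_def less_imp_le)
  from orbit_bounds(2)[OF x(1,2) this(1,2)] this(3) show ?thesis by simp
qed

text \<open>The lower radius bound is a positive multiple of the initial radius, so the orbit never
  meets the vertical axis and its angle is defined up to the exit.\<close>

lemma radius_pos:
  assumes x: "x \<in> B1" "0 < x $ 3" "x $ 3 < 1" and "t \<in> {0..\<tau> x}" "PL x \<noteq> 0"
  shows "PL (G t x) \<noteq> 0"
proof -
  have "is_transit x (\<tau> x)" using is_transit_transit_time[OF x] .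
  then have "0 \<le> t" "\<And>s. 0 \<le> s \<Longrightarrow> s < t \<Longrightarrow> G s x $ 3 \<le> 1"
    using assms(4) by (auto simp: is_transit_def less_imp_le)
  from orbit_bounds(2)[OF x(1,2) this] obtain n where
    "exp (\<sigma> * t) * (1 - q) ^ Suc n * norm (PL x) \<le> norm (PL (G t x))" by blast
  moreover have "0 < exp (\<sigma> * t) * (1 - q) ^ Suc n * norm (PL x)"
    using q assms(5) by simp
  ultimately show ?thesis by auto
qed

text \<open>The derivative \<open>d\<close> of the height at the exit is positive, since the height
  was below 1 before. So the height exceeds 1 at a time \<open>h\<close> after the exit, which
  persists for nearby points and bounds their transit times from above. Up to time \<open>h\<close>
  before the exit the height stays below 1 on a compact interval, and the tube lemma makes this
  uniform near \<open>x\<close>, which bounds them from below.\<close>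

lemma transit_time_continuous_at:
  assumes x: "x \<in> B1" "0 < x $ 3" "x $ 3 < 1"
    and D: "((\<lambda>s. G s (inner_map G x) $ 3) has_real_derivative d) (at 0)" "d \<noteq> 0"
    and S: "S \<subseteq> {x \<in> B1. 0 < x $ 3 \<and> x $ 3 < 1}"
  shows "continuous (at x within S) \<tau>"
  unfolding continuous_within tendsto_iff
proof (intro allI impI)
  fix e :: real assume "0 < e"
  let ?y = "inner_map G x"
  have tr: "0 < \<tau> x" "\<And>s. 0 \<le> s \<Longrightarrow> s < \<tau> x \<Longrightarrow> G s x $ 3 < 1" and y3: "?y $ 3 = 1"
    using is_transit_transit_time[OF x] by (auto simp: is_transit_def inner_map_def)
  have y: "G s ?y = G (s + \<tau> x) x" for s
    by (simp add: flow_add inner_map_def)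
  have "0 < d"
  proof (rule ccontr)
    assume "\<not> 0 < d"
    then have "d < 0" using D by simp
    from DERIV_neg_dec_left[OF D(1) this] obtain b where b: "0 < b"
      "\<And>h. 0 < h \<Longrightarrow> h < b \<Longrightarrow> G 0 ?y $ 3 < G (0 - h) ?y $ 3" by blast
    define h where "h = min (b / 2) (\<tau> x)"
    have "1 < G (\<tau> x - h) x $ 3" using b(2)[of h] b(1) tr y3 y[of "- h"] by (simp add: h_def)
    moreover have "G (\<tau> x - h) x $ 3 < 1" using tr b by (intro tr) (auto simp: h_def)
    ultimately show False by simp
  qed
  from DERIV_pos_inc_right[OF D(1) this] obtain b where b: "0 < b"
      "\<And>h. 0 < h \<Longrightarrow> h < b \<Longrightarrow> G 0 ?y $ 3 < G (0 + h) ?y $ 3" by blast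
  define h where "h = min (b / 2) (e / 2)"
  have h: "0 < h" "h < e" "h < b" using b \<open>0 < e\<close> by (auto simp: h_def)
  have up: "1 < G (\<tau> x + h) x $ 3"
    using b(2)[of h] h y3 y[of h] by (simp add: add.commute)
  have at: "isCont (\<lambda>z. G t z $ 3) x" for t
    by (rule continuous_on_eq_continuous_at[THEN iffD1, rule_format, OF open_UNIV])
      (auto intro!: continuous_intros continuous_flow)
  have ev_up: "\<forall>\<^sub>F z in at x within S. 1 < G (\<tau> x + h) z $ 3"
    by (rule order_tendstoD(1)[OF tendsto_within_subset[OF at[unfolded isCont_def] subset_UNIV] up])
  define l where "l = max 0 (\<tau> x - h)"
  have "\<forall>\<^sub>F z in nhds x. \<forall>s\<in>{0..l}. G s z $ 3 < 1"
  proof -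
    have op: "open {p. G (snd p) (fst p) $ 3 < 1}"
      by (intro open_Collect_less continuous_intros continuous_flow)
    have "{x} \<times> {0..l} \<subseteq> {p. G (snd p) (fst p) $ 3 < 1}"
      using tr h by (auto simp: l_def)
    from Elementary_Topology.tube_lemma[OF compact_Icc op this] obtain W
      where "open W" "x \<in> W" "W \<times> {0..l} \<subseteq> {p. G (snd p) (fst p) $ 3 < 1}" by blast
    then show ?thesis unfolding eventually_nhds by (intro exI[of _ W]) auto
  qed
  then have ev_down: "\<forall>\<^sub>F z in at x within S. \<forall>s\<in>{0..l}. G s z $ 3 < 1"
    unfolding eventually_at_filter by (rule eventually_mono) auto
  have "\<forall>\<^sub>F z in at x within S. z \<in> S"
    by (simp add: eventually_at_filter)
  with ev_up ev_down show "\<forall>\<^sub>F z in at x within S. dist (\<tau> z) (\<tau> x) < e"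
  proof eventually_elim
    case (elim z)
    then have tz: "is_transit z (\<tau> z)" using S by (intro is_transit_transit_time) auto
    have "\<tau> z \<notin> {0..l}" using tz elim(2) unfolding is_transit_def by (metis less_irrefl)
    moreover have "\<tau> z \<le> \<tau> x + h"
    proof (rule ccontr)
      assume "\<not> \<tau> z \<le> \<tau> x + h"
      then have "G (\<tau> x + h) z $ 3 < 1" using tz tr h by (auto simp: is_transit_def)
      then show False using elim(1) by simp
    qed
    ultimately show ?case using tz h by (auto simp: is_transit_def l_def dist_real_def)
  qed
qed

end

section \<open>Deviation of the scaled flow from its linearization\<close>

lemma norm_PL: "norm (PL x) = sqrt ((x $ 1)\<^sup>2 + (x $ 2)\<^sup>2)"
  by (simp add: norm_vec_def L2_set_def sum_3)

lemma linear_PU: "linear PU"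
  by (intro linearI) (simp_all add: vec_eq_iff forall_3)

lemma convex_B1: "convex B1"
proof -
  have eq: "B1 = PL -` cball 0 1 \<inter> PU -` cball 0 1"
    by (auto simp: B1_def)
  show ?thesis
    unfolding eq by (intro convex_Int convex_linear_vimage linear_PL linear_PU convex_cball)
qed

lemma C1_on_imp_continuous_on: "C1_on f S \<Longrightarrow> continuous_on S f"
  unfolding C1_on_def by (auto intro: has_derivative_continuous_on)

context
  fixes F :: "real \<Rightarrow> real^3 \<Rightarrow> real^3"
  assumes C1: "C1_on (\<lambda>(t, x). F t x) UNIV"
begin

lemma flow_differentiable_compose:
  assumes "f differentiable at a" "g differentiable at a"
  shows "(\<lambda>x. F (f x) (g x)) differentiable at a"
proof -
  have "(\<lambda>(t, x). F t x) differentiable at (f a, g a)"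
    using C1 by (auto simp: C1_on_def differentiable_def)
  moreover have "(\<lambda>x. (f x, g x)) differentiable at a"
    using assms by (auto simp: differentiable_def intro!: has_derivative_Pair)
  ultimately have "((\<lambda>(t, x). F t x) \<circ> (\<lambda>x. (f x, g x))) differentiable at a"
    by (intro differentiable_chain_at)
  then show ?thesis by (simp add: o_def)
qed

lemma scaled_differentiable_compose:
  assumes "f differentiable at a" "g differentiable at a"
  shows "(\<lambda>x. scaled F e (f x) (g x)) differentiable at a"
  unfolding scaled_def using assms
  by (intro differentiable_scaleR flow_differentiable_compose) auto

lemma continuous_scaled: "continuous_on UNIV (\<lambda>(t, x). scaled F e t x)"
proof -
  have "continuous_on UNIV (\<lambda>p. (\<lambda>(t, x). F t x) (fst p, e *\<^sub>R snd p))"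
    by (intro continuous_on_compose2[OF C1_on_imp_continuous_on[OF C1]] continuous_intros) auto
  then show ?thesis
    unfolding scaled_def case_prod_unfold by (auto intro!: continuous_intros)
qed

text \<open>The difference of flow and linear map has Lipschitz constant \<eta> on the convex set
  \<open>B1\<close>. It is compared at \<open>x\<close> and \<open>PL x\<close>, where both vertical
  components vanish by invariance of \<open>Lspace\<close>, and at \<open>x\<close> and
  \<open>PU x\<close>, where both horizontal parts vanish. Comparison with the origin would only
  give errors relative to the full norm.\<close>

lemma one_step_bounds:
  fixes A :: "real^3 \<Rightarrow> real^3" and e :: real
  defines "G \<equiv> scaled F e"
  assumes flow: "is_flow F" and e: "0 < e" and t: "t \<in> {0..1}" and x: "x \<in> B1"
    and close: "\<And>x. x \<in> B1 \<Longrightarrow> onorm (\<lambda>y. D2 G t x y - A y) < \<eta>"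
    and stay: "\<And>t. t \<in> {0..1} \<Longrightarrow> G t ` B1 \<subseteq> N"
    and inv: "invariant_in Lspace G N" "invariant_in Uspace G N"
    and A: "bounded_linear A" "\<And>x. A (PL x) \<in> Lspace" "\<And>x. A (PU x) \<in> Uspace"
  shows "\<bar>G t x $ 3 - A x $ 3\<bar> \<le> \<eta> * \<bar>x $ 3\<bar>"
    "norm (PL (G t x) - PL (A x)) \<le> \<eta> * norm (PL x)"
proof -
  have G0: "G 0 y = y" for y
    using flow e by (simp add: G_def scaled_def is_flow_def)
  have "B1 \<subseteq> N" using stay[of 0] G0 by force
  have B1: "PL x \<in> B1" "PU x \<in> B1"
    using x by (auto simp: B1_def norm_PL)
  have inv_t: "G t y \<in> M" if "invariant_in M G N" "y \<in> M" "y \<in> B1" for M y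
  proof -
    have "(\<lambda>t. G t y) ` {0..1} \<subseteq> N" using stay that by blast
    moreover have "y \<in> M \<inter> N" using that \<open>B1 \<subseteq> N\<close> by blast
    ultimately have "(\<lambda>t. G t y) ` {0..1} \<subseteq> M"
      using that(1) unfolding invariant_in_def by (metis atLeastAtMost_iff is_interval_cc order_refl zero_le_one)
    then show ?thesis using t by auto
  qed
  have bound: "norm ((G t x - A x) - (G t y - A y)) \<le> \<eta> * norm (x - y)" if "y \<in> B1" for y
  proof (rule differentiable_bound[OF convex_B1 _ _ x that])
    fix z assume z: "z \<in> B1"
    have "G t differentiable at z"
      using scaled_differentiable_compose[of "\<lambda>_. t" z "\<lambda>x. x" e] by (simp add: G_def)
    then have "(G t has_derivative D2 G t z) (at z)"
      unfolding D2_def using frechet_derivative_works by blast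
    then show "((\<lambda>z. G t z - A z) has_derivative (\<lambda>y. D2 G t z y - A y)) (at z within B1)"
      by (rule has_derivative_at_withinI[OF has_derivative_diff[OF _ bounded_linear_imp_has_derivative[OF A(1)]]])
    show "onorm (\<lambda>y. D2 G t z y - A y) \<le> \<eta>"
      using close[OF z] by simp
  qed
  have split: "x - PL x = PU x" "x - PU x = PL x"
    by (simp_all add: vec_eq_iff forall_3)
  have "G t (PL x) $ 3 = 0" "A (PL x) $ 3 = 0"
    using inv_t[OF inv(1) _ B1(1)] A(2)[of x] by (auto simp: Lspace_iff)
  then have "\<bar>G t x $ 3 - A x $ 3\<bar> = \<bar>((G t x - A x) - (G t (PL x) - A (PL x))) $ 3\<bar>"
    by simp
  also have "\<dots> \<le> norm ((G t x - A x) - (G t (PL x) - A (PL x)))"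
    by (rule component_le_norm_cart)
  also have "\<dots> \<le> \<eta> * \<bar>x $ 3\<bar>"
    using bound[OF B1(1)] unfolding split by simp
  finally show "\<bar>G t x $ 3 - A x $ 3\<bar> \<le> \<eta> * \<bar>x $ 3\<bar>" .
  have "PL (G t (PU x)) = 0" "PL (A (PU x)) = 0"
    using inv_t[OF inv(2) _ B1(2)] A(3)[of x] by (auto simp: Uspace_iff vec_eq_iff forall_3)
  then have "norm (PL (G t x) - PL (A x)) = norm (PL ((G t x - A x) - (G t (PU x) - A (PU x))))"
    by (simp add: linear_diff[OF linear_PL])
  also have "\<dots> \<le> norm ((G t x - A x) - (G t (PU x) - A (PU x)))"
    by (rule norm_PL_le)
  also have "\<dots> \<le> \<eta> * norm (PL x)"
    using bound[OF B1(2)] unfolding split by simp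
  finally show "norm (PL (G t x) - PL (A x)) \<le> \<eta> * norm (PL x)" .
qed

text \<open>Passing from vectors to their norms removes the rotation of the linear flow; the angle
  is followed separately, by a continuous logarithm.\<close>

lemma one_step_bounds_spiral:
  fixes e :: real
  defines "G \<equiv> scaled F e"
  assumes flow: "is_flow F" and e: "0 < e" and t: "t \<in> {0..1}" and x: "x \<in> B1"
    and A: "\<And>x. D2 F t 0 x = vector [exp (\<sigma> * t) * (cos (\<mu> * t) * x $ 1 + sin (\<mu> * t) * x $ 2),
                                 exp (\<sigma> * t) * (- sin (\<mu> * t) * x $ 1 + cos (\<mu> * t) * x $ 2),
                                 exp (u * t) * x $ 3]"
    and close: "\<And>x. x \<in> B1 \<Longrightarrow> onorm (\<lambda>y. D2 G t x y - D2 F t 0 y) < \<eta>"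
    and stay: "\<And>t. t \<in> {0..1} \<Longrightarrow> G t ` B1 \<subseteq> N"
    and inv: "invariant_in Lspace G N" "invariant_in Uspace G N"
  shows "\<bar>G t x $ 3 - exp (u * t) * x $ 3\<bar> \<le> \<eta> * \<bar>x $ 3\<bar>"
    "\<bar>norm (PL (G t x)) - exp (\<sigma> * t) * norm (PL x)\<bar> \<le> \<eta> * norm (PL x)"
proof -
  have "(\<lambda>y. F t y) differentiable at 0"
    by (intro flow_differentiable_compose) auto
  then have bl: "bounded_linear (D2 F t 0)"
    unfolding D2_def using frechet_derivative_works has_derivative_bounded_linear by blast
  note bounds = one_step_bounds[OF flow e t x, of "D2 F t 0" \<eta> N, folded G_def,
      OF close stay inv bl]
  have n: "norm (PL (D2 F t 0 x)) = exp (\<sigma> * t) * norm (PL x)"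
  proof -
    have "(c * a + s * b)\<^sup>2 + (- s * a + c * b)\<^sup>2 = (c\<^sup>2 + s\<^sup>2) * (a\<^sup>2 + b\<^sup>2)" for a b c s :: real
      by (simp add: power2_eq_square algebra_simps)
    from this[of "cos (\<mu> * t)" "x $ 1" "sin (\<mu> * t)" "x $ 2"] have
      "(cos (\<mu> * t) * x $ 1 + sin (\<mu> * t) * x $ 2)\<^sup>2 + (- sin (\<mu> * t) * x $ 1 + cos (\<mu> * t) * x $ 2)\<^sup>2
        = (x $ 1)\<^sup>2 + (x $ 2)\<^sup>2"
      by simp
    moreover have "(e' * p)\<^sup>2 + (e' * q)\<^sup>2 = e'\<^sup>2 * (p\<^sup>2 + q\<^sup>2)" for e' p q :: real
      by (simp add: power_mult_distrib distrib_left)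
    ultimately show ?thesis
      unfolding norm_PL A by (simp only: vector_3 real_sqrt_mult real_sqrt_abs abs_exp_cancel)
  qed
  show "\<bar>G t x $ 3 - exp (u * t) * x $ 3\<bar> \<le> \<eta> * \<bar>x $ 3\<bar>"
    using bounds(1) by (simp add: A Lspace_iff Uspace_iff)
  have "\<bar>norm (PL (G t x)) - norm (PL (D2 F t 0 x))\<bar> \<le> norm (PL (G t x) - PL (D2 F t 0 x))"
    by (rule norm_triangle_ineq3)
  also have "\<dots> \<le> \<eta> * norm (PL x)"
    using bounds(2) by (simp add: A Lspace_iff Uspace_iff)
  finally show "\<bar>norm (PL (G t x)) - exp (\<sigma> * t) * norm (PL x)\<bar> \<le> \<eta> * norm (PL x)"
    unfolding n .
qed

end

lemma is_flow_scaled: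
  assumes "is_flow F" "e \<noteq> 0"
  shows "is_flow (scaled F e)"
  using assms by (simp add: is_flow_def scaled_def)

section \<open>Coordinates\<close>

text \<open>Horizontal parts become complex numbers, so that \<open>Ln\<close>, \<open>cis\<close>
  and continuous logarithms are available for angles.\<close>

definition plane :: "real^3 \<Rightarrow> complex" where
  "plane x = Complex (x $ 1) (x $ 2)"

lemma norm_plane: "norm (plane x) = norm (PL x)"
  by (simp add: plane_def norm_PL complex_norm)

lemma linear_plane: "linear plane"
  by (intro linearI) (simp_all add: plane_def complex_eq_iff)

lemma bounded_linear_plane: "bounded_linear plane"
  by (rule linear_conv_bounded_linear[THEN iffD1, OF linear_plane])

lemma continuous_on_plane [continuous_intros]:
  "continuous_on S f \<Longrightarrow> continuous_on S (\<lambda>x. plane (f x))"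
  by (rule bounded_linear.continuous_on[OF bounded_linear_plane])

lemma cis_eq_imp_eq:
  assumes "cis a = cis b" "\<bar>a - b\<bar> < 2 * pi"
  shows "a = b"
proof -
  have "cos (a - b) = 1"
    using arg_cong[OF assms(1), of Re] arg_cong[OF assms(1), of Im]
    by (simp add: cos_diff flip: power2_eq_square)
  then obtain n :: int where n: "a - b = n * 2 * pi"
    using cos_one_2pi_int by auto
  then have "\<bar>real_of_int n\<bar> * (2 * pi) < 1 * (2 * pi)"
    using assms(2) by (simp add: abs_mult)
  then have "\<bar>real_of_int n\<bar> < 1"
    by (rule mult_right_less_imp_less) simp
  then have "n = 0" by linarith
  then show ?thesis using n by simp
qed

text \<open>The difference of two lifts is continuous, zero at 0 and always a multiple of 2 pi. If
  it were positive at \<open>T\<close>, it would attain \<open>min pi (g T - f T)\<close>, which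
  lies strictly between 0 and 2 pi. This justifies the \<open>THE\<close> in
  \<open>angle_fun\<close>.\<close>

lemma cis_lift_unique:
  fixes f g :: "real \<Rightarrow> real"
  assumes "continuous_on {0..T} f" "continuous_on {0..T} g" "0 \<le> T" "f 0 = g 0"
    and eq: "\<And>t. t \<in> {0..T} \<Longrightarrow> cis (f t) = cis (g t)"
  shows "f T = g T"
proof (rule ccontr)
  have half: False if "continuous_on {0..T} f" "continuous_on {0..T} g" "f 0 = g 0" "f T < g T"
      "\<And>t. t \<in> {0..T} \<Longrightarrow> cis (f t) = cis (g t)" for f g :: "real \<Rightarrow> real"
  proof -
    have "\<exists>t\<ge>0. t \<le> T \<and> g t - f t = min pi (g T - f T)"
      using that(1-4) \<open>0 \<le> T\<close> by (intro IVT'[of "\<lambda>t. g t - f t"]) (auto intro!: continuous_intros)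
    then obtain t where t: "0 \<le> t" "t \<le> T" "g t - f t = min pi (g T - f T)" by auto
    have d: "0 < g t - f t" "g t - f t \<le> pi"
      unfolding t(3) using that(4) by auto
    then have "\<bar>f t - g t\<bar> < 2 * pi"
      using pi_gt_zero by linarith
    then have "f t = g t"
      using t by (intro cis_eq_imp_eq that(5)) auto
    then show False using d by simp
  qed
  assume "f T \<noteq> g T"
  then show False
    using half[of f g] half[of g f] assms by (cases "f T < g T") auto
qed

lemma continuous_on_Kmap: "continuous_on S (Kmap E)"
proof -
  have "Kmap E = (\<lambda>p. cos (base_angle E + fst p) *\<^sub>R axis 1 1 + sin (base_angle E + fst p) *\<^sub>R axis 2 1
      + snd p *\<^sub>R axis 3 1)"
    by (simp add: fun_eq_iff Kmap_def vec_eq_iff forall_3 axis_def)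
  then show ?thesis by (auto intro!: continuous_intros)
qed

lemma Kmap_plane:
  "Kmap E p $ 3 = snd p" "plane (Kmap E p) = cis (base_angle E + fst p)" "Kmap E p \<in> MI"
  by (simp_all add: Kmap_def plane_def complex_eq_iff MI_def norm_PL)

context
  fixes E :: "real^3 \<Rightarrow> real^3"
  assumes E_e3: "E e3 \<in> Lspace" "norm (E e3) = 1"
begin

lemma vector_base_angle: "vector [cos (base_angle E), sin (base_angle E), 0] = E e3"
proof -
  have E3: "E e3 $ 3 = 0" using E_e3 by (simp add: Lspace_iff)
  have eq: "vector [cos a, sin a, 0] = E e3 \<longleftrightarrow> cis a = plane (E e3)" for a
    using E3 by (simp add: vec_eq_iff forall_3 plane_def complex_eq_iff)
  have "norm (plane (E e3)) = 1"
    using E_e3(2) E3 by (simp add: norm_plane norm_PL norm_vec_def L2_set_def sum_3)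
  then obtain t where t: "0 \<le> t" "t < 2 * pi" "plane (E e3) = cis t"
    using Arg2pi[of "plane (E e3)"] by (intro that[of "Arg2pi (plane (E e3))"]) (auto simp: cis_conv_exp is_Arg_def)
  \<comment> \<open>\<open>Arg2pi\<close> has values in [0, 2 pi); those from pi on are shifted down
    by 2 pi.\<close>
  have "\<exists>a. - pi \<le> a \<and> a < pi \<and> cis a = plane (E e3)"
  proof (cases "t < pi")
    case True
    then show ?thesis using t by (intro exI[of _ t]) auto
  next
    case False
    then show ?thesis using t by (intro exI[of _ "t - 2 * pi"]) (auto simp flip: cis_divide)
  qed
  moreover have "a = b" if "- pi \<le> a \<and> a < pi \<and> cis a = plane (E e3)"
    "- pi \<le> b \<and> b < pi \<and> cis b = plane (E e3)" for a b
    using that by (intro cis_eq_imp_eq) auto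
  ultimately have "\<exists>!a. - pi \<le> a \<and> a < pi \<and> vector [cos a, sin a, 0] = E e3"
    unfolding eq by blast
  from theI'[OF this] show ?thesis unfolding base_angle_def by blast
qed

lemma plane_E_e3: "plane (E e3) = cis (base_angle E)"
  unfolding vector_base_angle[symmetric] by (simp add: plane_def complex_eq_iff)

text \<open>Rotation by \<open>- base_angle E\<close> turns the excluded direction
  \<open>- E e3\<close> into the negative real axis, the branch cut of \<open>Ln\<close>. So the
  inverse chart is explicit, and continuous and differentiable where \<open>Ln\<close> is.\<close>

lemma Kinv_formula:
  assumes "z \<in> MI" "PL z \<noteq> - E e3"
  shows "Kinv E z = (Im (Ln (plane z * cis (- base_angle E))), z $ 3)"
    and "plane z * cis (- base_angle E) \<notin> \<real>\<^sub>\<le>\<^sub>0"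
proof -
  define y where "y = plane z * cis (- base_angle E)"
  have E3: "E e3 $ 3 = 0" using E_e3 by (simp add: Lspace_iff)
  have "norm y = 1" using assms(1) by (simp add: y_def norm_mult norm_plane MI_def)
  have yz: "plane z = cis (base_angle E) * y"
    by (simp add: y_def mult.left_commute cis_mult)
  have "y \<noteq> -1"
  proof
    assume "y = -1"
    then have "plane z = - plane (E e3)" using yz plane_E_e3 by simp
    then have "PL z = - E e3" using E3 by (simp add: plane_def complex_eq_iff vec_eq_iff forall_3)
    then show False using assms(2) by simp
  qed
  have nonpos: "y \<notin> \<real>\<^sub>\<le>\<^sub>0"
  proof
    assume "y \<in> \<real>\<^sub>\<le>\<^sub>0"
    then obtain r where "y = complex_of_real r" "r \<le> 0" by (auto elim: nonpos_Reals_cases)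
    then show False using \<open>norm y = 1\<close> \<open>y \<noteq> -1\<close> by auto
  qed
  then have "y \<noteq> 0" by auto
  define a where "a = Im (Ln y)"
  have "cis a = y"
    using exp_Ln[OF \<open>y \<noteq> 0\<close>] \<open>norm y = 1\<close> \<open>y \<noteq> 0\<close> by (simp add: a_def exp_eq_polar)
  have "- pi < a" "a \<le> pi"
    using mpi_less_Im_Ln Im_Ln_le_pi \<open>y \<noteq> 0\<close> unfolding a_def by auto
  moreover have "a \<noteq> pi" using \<open>cis a = y\<close> \<open>y \<noteq> -1\<close> by auto
  ultimately have a: "- pi < a" "a < pi" by auto
  have "plane (Kmap E (a, z $ 3)) = plane z"
    unfolding Kmap_plane yz by (simp add: \<open>cis a = y\<close> flip: cis_mult)
  then have K: "Kmap E (a, z $ 3) = z"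
    by (simp add: plane_def complex_eq_iff vec_eq_iff forall_3 Kmap_plane(1))
  have "inj_on (Kmap E) ({-pi<..<pi} \<times> UNIV)"
  proof (rule inj_onI)
    fix p p' assume *: "p \<in> {-pi<..<pi} \<times> (UNIV :: real set)" "p' \<in> {-pi<..<pi} \<times> (UNIV :: real set)"
      "Kmap E p = Kmap E p'"
    have "cis (base_angle E + fst p) = cis (base_angle E + fst p')" "snd p = snd p'"
      using *(3) Kmap_plane(1,2) by metis+
    moreover from this(1) have "base_angle E + fst p = base_angle E + fst p'"
      using * by (intro cis_eq_imp_eq) (auto simp: mem_Times_iff)
    ultimately show "p = p'" by (simp add: prod_eq_iff)
  qed
  then have "Kinv E (Kmap E (a, z $ 3)) = (a, z $ 3)"
    unfolding Kinv_def using a by (intro inv_into_f_f) auto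
  then have "Kinv E z = (a, z $ 3)"
    unfolding K .
  then show "Kinv E z = (Im (Ln (plane z * cis (- base_angle E))), z $ 3)"
    unfolding a_def y_def .
  show "plane z * cis (- base_angle E) \<notin> \<real>\<^sub>\<le>\<^sub>0" using nonpos unfolding y_def .
qed

lemma continuous_on_Kinv: "continuous_on {z \<in> MI. PL z \<noteq> - E e3} (Kinv E)"
proof -
  have "continuous_on {z \<in> MI. PL z \<noteq> - E e3} (\<lambda>z. (Im (Ln (plane z * cis (- base_angle E))), z $ 3))"
    using Kinv_formula(2) by (intro continuous_intros) auto
  then show ?thesis
    by (rule continuous_on_eq) (use Kinv_formula(1) in auto)
qed

text \<open>The cylinder \<open>MI\<close> has empty interior, so a derivative of
  \<open>Kinv E\<close> in three-space is not at hand. The logarithm formula makes sense near the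
  cylinder and agrees with \<open>Kinv E\<close> along maps into it.\<close>

lemma Kinv_differentiable_compose:
  assumes f: "f differentiable (at a)" and U: "open U" "a \<in> U"
    and range: "\<And>x. x \<in> U \<Longrightarrow> f x \<in> MI \<and> PL (f x) \<noteq> - E e3"
  shows "(\<lambda>x. Kinv E (f x)) differentiable (at a)"
proof -
  obtain f' where f': "(f has_derivative f') (at a)"
    using f by (auto simp: differentiable_def)
  have "((\<lambda>x. plane (f x) * cis (- base_angle E)) has_derivative (\<lambda>h. plane (f' h) * cis (- base_angle E))) (at a)"
    by (intro has_derivative_mult_left bounded_linear.has_derivative[OF bounded_linear_plane] f')
  moreover have "(Ln has_derivative (*) (inverse (plane (f a) * cis (- base_angle E)))) (at (plane (f a) * cis (- base_angle E)))"
    using has_field_derivative_Ln[OF Kinv_formula(2)] range[OF U(2)]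
    by (auto intro: has_field_derivative_imp_has_derivative)
  ultimately have "((\<lambda>x. Ln (plane (f x) * cis (- base_angle E))) has_derivative
      (\<lambda>h. inverse (plane (f a) * cis (- base_angle E)) * (plane (f' h) * cis (- base_angle E)))) (at a)"
    by (rule has_derivative_compose)
  then have "((\<lambda>x. (Im (Ln (plane (f x) * cis (- base_angle E))), f x $ 3)) has_derivative
      (\<lambda>h. (Im (inverse (plane (f a) * cis (- base_angle E)) * (plane (f' h) * cis (- base_angle E))), f' h $ 3))) (at a)"
    by (intro has_derivative_Pair bounded_linear.has_derivative[OF bounded_linear_Im]
        bounded_linear.has_derivative[OF bounded_linear_vec_nth] f')
  then have "((\<lambda>x. Kinv E (f x)) has_derivative
      (\<lambda>h. (Im (inverse (plane (f a) * cis (- base_angle E)) * (plane (f' h) * cis (- base_angle E))), f' h $ 3))) (at a)"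
    by (rule has_derivative_transform_within_open[OF _ U]) (use range Kinv_formula(1) in auto)
  then show ?thesis by (auto simp: differentiable_def)
qed

end

lemma ME_iff: "y \<in> ME r \<longleftrightarrow> y $ 3 = 1 \<and> norm (PL y) < r"
proof -
  have "PL y = y - e3" if "y $ 3 = 1"
    using that by (simp add: vec_eq_iff forall_3 e3_def axis_def)
  then show ?thesis
    by (auto simp: ME_def Lspace_iff e3_def axis_def)
qed

lemma e3_nth [simp]: "e3 $ 1 = 0" "e3 $ 2 = 0" "e3 $ 3 = 1"
  by (simp_all add: e3_def axis_def)

lemma PL_e3 [simp]: "PL (e3 + PL x) = PL x" "PL e3 = 0"
  by (simp_all add: vec_eq_iff forall_3)

text \<open>On the disc only a derivative within the affine plane is given. Composition with the
  projection gives a map on an open set of three-space, in the form in which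
  \<open>tangent_e3\<close> differentiates.\<close>

lemma C1_on_ME_differentiable:
  assumes "C1_on (T :: real^3 \<Rightarrow> real) (ME r)" "0 < r"
  shows "(\<lambda>x. T (e3 + PL x)) differentiable (at 0)"
proof -
  define U where "U = {x. norm (PL x) < r}"
  have "open U" "0 \<in> U"
    unfolding U_def using assms(2) linear_0[OF linear_PL]
    by (auto intro!: open_Collect_less continuous_intros)
  have "e3 \<in> ME r" using assms(2) by (simp add: ME_iff)
  then obtain T' where T': "(T has_derivative T') (at e3 within ME r)"
    using assms(1) \<open>e3 \<in> ME r\<close> unfolding C1_on_def by blast
  have "((\<lambda>x. e3 + PL x) has_derivative PL) (at 0 within U)"
    by (auto intro!: derivative_eq_intros bounded_linear_imp_has_derivative bounded_linear_PL)
  moreover have "(T has_derivative T') (at (e3 + PL 0) within (\<lambda>x. e3 + PL x) ` U)"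
    unfolding linear_0[OF linear_PL] add_0_right
    by (rule has_derivative_subset[OF T']) (auto simp: ME_iff U_def)
  ultimately have "(T \<circ> (\<lambda>x. e3 + PL x) has_derivative T' \<circ> PL) (at 0 within U)"
    by (rule diff_chain_within)
  then show ?thesis
    unfolding at_within_open[OF \<open>0 \<in> U\<close> \<open>open U\<close>] by (auto simp: o_def differentiable_def)
qed

section \<open>Linear coordinates with respect to \<open>v\<close> and \<open>w\<close>, by Cramer's
  rule\<close>

definition det2 :: "real^3 \<Rightarrow> real^3 \<Rightarrow> real" where
  "det2 v w = v $ 1 * w $ 2 - v $ 2 * w $ 1"

text \<open>If the determinant vanished, two linear combinations of \<open>v\<close> and
  \<open>w\<close> with entries of these vectors as coefficients would be 0. \<open>D\<close> reads
  off the coefficients, so \<open>v\<close> would be 0, against D v = (1, 0).\<close>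

lemma det2_nonzero:
  fixes D :: "real^3 \<Rightarrow> real \<times> real"
  assumes "linear D" "v \<in> Lspace" "w \<in> Lspace" "D v = (1, 0)" "D w = (0, 1)"
  shows "det2 v w \<noteq> 0"
proof
  assume *: "det2 v w = 0"
  have D: "D (a *\<^sub>R v + b *\<^sub>R w) = (a, b)" for a b
    using assms by (simp add: linear_add linear_scale)
  have "(w $ 2) *\<^sub>R v + (- v $ 2) *\<^sub>R w = 0" "(w $ 1) *\<^sub>R v + (- v $ 1) *\<^sub>R w = 0"
    using * assms(2,3) by (simp_all add: vec_eq_iff forall_3 Lspace_iff det2_def algebra_simps)
  then have "v $ 1 = 0 \<and> v $ 2 = 0"
    using D[of "w $ 2" "- v $ 2"] D[of "w $ 1" "- v $ 1"] linear_0[OF assms(1)] by (simp add: zero_prod_def)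
  then have "v = 0" using assms(2) by (simp add: vec_eq_iff forall_3 Lspace_iff)
  then show False using assms(4) linear_0[OF assms(1)] by (simp add: zero_prod_def)
qed

context
  fixes v w :: "real^3"
  assumes vw: "v \<in> Lspace" "w \<in> Lspace" and det: "det2 v w \<noteq> 0"
begin

lemma kappa_inv_eq_iff:
  assumes "x \<in> Lspace"
  shows "kappa_inv v w p = x \<longleftrightarrow> p = (det2 x w / det2 v w, det2 v x / det2 v w)"
proof
  assume x: "kappa_inv v w p = x"
  have "det2 x w = fst p * det2 v w" "det2 v x = snd p * det2 v w"
    unfolding x[symmetric] by (simp_all add: kappa_inv_def det2_def algebra_simps)
  then show "p = (det2 x w / det2 v w, det2 v x / det2 v w)"
    using det by (simp add: prod_eq_iff)
next
  assume p: "p = (det2 x w / det2 v w, det2 v x / det2 v w)"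
  have "kappa_inv v w p = (1 / det2 v w) *\<^sub>R (det2 x w *\<^sub>R v + det2 v x *\<^sub>R w)"
    by (simp add: p kappa_inv_def scaleR_add_right)
  also have "det2 x w *\<^sub>R v + det2 v x *\<^sub>R w = det2 v w *\<^sub>R x"
    using vw assms by (simp add: vec_eq_iff forall_3 Lspace_iff det2_def algebra_simps)
  finally show "kappa_inv v w p = x" using det by simp
qed

lemma kappa_formula:
  assumes "x \<in> Lspace"
  shows "kappa v w x = (det2 x w / det2 v w, det2 v x / det2 v w)"
  unfolding kappa_def kappa_inv_eq_iff[OF assms] by simp

lemma kappa_inv_kappa: "x \<in> Lspace \<Longrightarrow> kappa_inv v w (kappa v w x) = x"
  by (simp add: kappa_inv_eq_iff kappa_formula)

lemma kappa_PL: "kappa v w (PL x) = (det2 x w / det2 v w, det2 v x / det2 v w)"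
  by (subst kappa_formula) (simp_all add: Lspace_iff det2_def)

lemma kappa_inv_kappa_PL: "kappa_inv v w (kappa v w (PL x)) = PL x"
  by (rule kappa_inv_kappa) (simp add: Lspace_iff)

lemma bounded_linear_kappa_PL: "bounded_linear (\<lambda>x. kappa v w (PL x))"
proof -
  have "linear (\<lambda>x. kappa v w (PL x))"
    by (intro linearI) (simp_all add: kappa_PL det2_def algebra_simps add_divide_distrib diff_divide_distrib)
  then show ?thesis by (simp add: linear_conv_bounded_linear)
qed

lemma bounded_linear_kappa_inv: "bounded_linear (kappa_inv v w)"
proof -
  have "linear (kappa_inv v w)"
    by (intro linearI) (simp_all add: kappa_inv_def algebra_simps)
  then show ?thesis by (simp add: linear_conv_bounded_linear)
qed

lemma norm_kappa_PL_le: "norm (kappa v w (PL x)) \<le> kappa_norm v w * norm (PL x)"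
proof -
  have "norm (kappa v w (PL (PL x))) \<le> kappa_norm v w * norm (PL x)"
    unfolding kappa_norm_def by (rule onorm[OF bounded_linear_kappa_PL])
  moreover have "PL (PL x) = PL x"
    by (simp add: vec_eq_iff forall_3)
  ultimately show ?thesis by simp
qed

lemma kappa_norm_nonneg: "0 \<le> kappa_norm v w"
  unfolding kappa_norm_def by (rule onorm_pos_le[OF bounded_linear_kappa_PL])

lemma norm_PL_le_kappa: "norm (PL x) \<le> onorm (kappa_inv v w) * norm (kappa v w (PL x))"
  using onorm[OF bounded_linear_kappa_inv, of "kappa v w (PL x)"] by (simp add: kappa_inv_kappa_PL)

lemma kappa_scaled_w: "PL x = a *\<^sub>R w \<Longrightarrow> kappa v w (PL x) = (0, a)"
proof -
  have "det2 (a *\<^sub>R w) w = 0" "det2 v (a *\<^sub>R w) = a * det2 v w"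
    by (simp_all add: det2_def algebra_simps)
  moreover have "a *\<^sub>R w \<in> Lspace" using vw by (simp add: Lspace_iff)
  ultimately show "PL x = a *\<^sub>R w \<Longrightarrow> kappa v w (PL x) = (0, a)"
    using det by (simp add: kappa_formula)
qed

text \<open>\<open>Pmap v w\<close> is injective on the disc, so the inverse in
  \<open>exterior_in_coordinates\<close> cancels. Thus closeness of that map to the identity becomes
  an estimate for the return map.\<close>

lemma exterior_in_coordinates_Pmap:
  assumes "y \<in> ME r"
  shows "exterior_in_coordinates E r v w (kappa v w (PL y)) = Kinv E (E y)"
proof -
  have "inj_on (Pmap v w) (ME r)"
  proof (rule inj_onI)
    fix y z assume *: "y \<in> ME r" "z \<in> ME r" "Pmap v w y = Pmap v w z"
    then have "PL y = PL z"
      unfolding Pmap_def using kappa_inv_kappa_PL by metis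
    then have "y $ 1 = z $ 1" "y $ 2 = z $ 2" using PL_nth by metis+
    with * show "y = z" by (simp add: vec_eq_iff forall_3 ME_iff)
  qed
  then have "inv_into (ME r) (Pmap v w) (Pmap v w y) = y"
    using assms by (rule inv_into_f_f)
  then show ?thesis by (simp add: exterior_in_coordinates_def Pmap_def)
qed

end

section \<open>Transit time and angle\<close>

lemma unit_direction:
  assumes "plane y = norm (PL y) * cis a" "PL y \<noteq> 0"
  shows "PL y /\<^sub>R norm (PL y) = vector [cos a, sin a, 0]"
proof -
  define n where "n = norm (PL y)"
  have "n \<noteq> 0" using assms(2) by (simp add: n_def)
  have "y $ 1 = n * cos a" "y $ 2 = n * sin a"
    using arg_cong[OF assms(1), of Re] arg_cong[OF assms(1), of Im]
    by (simp_all add: plane_def flip: n_def)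
  then show ?thesis
    unfolding n_def[symmetric] using \<open>n \<noteq> 0\<close> by (simp add: vec_eq_iff forall_3)
qed

context near_linear_flow
begin

lemma continuous_on_transit_time:
  assumes S: "S \<subseteq> {x \<in> B1. 0 < x $ 3 \<and> x $ 3 < 1}"
    and D: "\<And>x. x \<in> S \<Longrightarrow> \<exists>d. ((\<lambda>s. G s (inner_map G x) $ 3) has_real_derivative d) (at 0) \<and> d \<noteq> 0"
  shows "continuous_on S (transit_time G)"
  unfolding continuous_on_eq_continuous_within
proof
  fix x assume "x \<in> S"
  moreover from D[OF this] obtain d where
    "((\<lambda>s. G s (inner_map G x) $ 3) has_real_derivative d) (at 0)" "d \<noteq> 0" by blast
  ultimately show "continuous (at x within S) (transit_time G)"
    using S by (intro transit_time_continuous_at[where d = d]) auto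
qed

lemma continuous_on_inner_map:
  "continuous_on S (transit_time G) \<Longrightarrow> continuous_on S (inner_map G)"
  unfolding inner_map_def by (intro continuous_flow continuous_on_id)

context
  fixes E :: "real^3 \<Rightarrow> real^3" and R :: "(real \<times> real) set"
  assumes R: "convex R" "\<And>p. p \<in> R \<Longrightarrow> 0 < snd p \<and> snd p < 1"
    and cont_\<tau>: "continuous_on (Kmap E ` R) (transit_time G)"
begin

lemma Kmap_start:
  assumes "p \<in> R"
  shows "Kmap E p \<in> B1" "0 < Kmap E p $ 3" "Kmap E p $ 3 < 1" "PL (Kmap E p) \<noteq> 0"
  using R(2)[OF assms] Kmap_plane(3)[of E p] by (auto simp: B1_def Kmap_plane MI_def)

lemma transit_time_Kmap_pos: "p \<in> R \<Longrightarrow> 0 < transit_time G (Kmap E p)"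
  using is_transit_transit_time[OF Kmap_start(1-3)] by (simp add: is_transit_def)

text \<open>A continuous logarithm of the projected orbits, with the time interval rescaled to \<open>[0, 1]\<close>,
  provides all angle functions at once.\<close>

lemma angle_fun_continuous_and_exact:
  shows "continuous_on R (angle_fun G E)"
    and "\<And>p. p \<in> R \<Longrightarrow> PL (inner_map G (Kmap E p)) /\<^sub>R norm (PL (inner_map G (Kmap E p)))
      = vector [cos (angle_fun G E p), sin (angle_fun G E p), 0]"
proof -
  let ?K = "Kmap E" and ?w = "base_angle E"
  define f where "f z = plane (G (snd z * \<tau> (?K (fst z))) (?K (fst z)))" for z
  have "continuous_on (R \<times> {0..1}) (\<lambda>z. \<tau> (?K (fst z)))"
    by (rule continuous_on_compose2[OF cont_\<tau>])
      (auto intro!: continuous_on_compose2[OF continuous_on_Kmap[of UNIV]] continuous_intros)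
  then have "continuous_on (R \<times> {0..1}) f"
    unfolding f_def
    by (auto intro!: continuous_intros continuous_flow continuous_on_compose2[OF continuous_on_Kmap[of UNIV]])
  moreover have "contractible (R \<times> {0..1::real})"
    by (intro convex_imp_contractible convex_Times R) auto
  moreover have "f z \<noteq> 0" if "z \<in> R \<times> {0..1}" for z
  proof -
    have p: "fst z \<in> R" and s: "0 \<le> snd z" "snd z \<le> 1" using that by auto
    have "snd z * \<tau> (?K (fst z)) \<in> {0..\<tau> (?K (fst z))}"
      using transit_time_Kmap_pos[OF p] s by (simp add: mult_left_le_one_le)
    from radius_pos[OF Kmap_start(1-3)[OF p] this Kmap_start(4)[OF p]]
    show ?thesis unfolding f_def by (metis norm_eq_zero norm_plane)
  qed
  ultimately obtain g where g: "continuous_on (R \<times> {0..1}) g" "\<And>z. z \<in> R \<times> {0..1} \<Longrightarrow> f z = exp (g z)"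
    using continuous_logarithm_on_contractible[of "R \<times> {0..1}" f] by metis
  \<comment> \<open>The logarithm fixes the angle only up to a multiple of 2 pi depending on
    \<open>p\<close>. Subtracting its value at time 0 and adding the prescribed initial angle
    normalizes all angle functions simultaneously and continuously.\<close>
  define \<Theta> where "\<Theta> p s = Im (g (p, s)) - Im (g (p, 0)) + ?w + fst p" for p s
  have g_cont: "continuous_on S (\<lambda>x. g (h x, k x))"
    if "continuous_on S h" "continuous_on S k" "\<And>x. x \<in> S \<Longrightarrow> h x \<in> R \<and> k x \<in> {0..1}"
    for S and h :: "'z::topological_space \<Rightarrow> real \<times> real" and k
    by (rule continuous_on_compose2[OF g(1)]) (use that in \<open>auto intro!: continuous_intros\<close>)
  have dir: "f (p, s) = norm (f (p, s)) * cis (\<Theta> p s)" if p: "p \<in> R" and s: "s \<in> {0..1}" for p s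
  proof -
    have polar: "f (p, s) = norm (f (p, s)) * cis (Im (g (p, s)))" if "s \<in> {0..1}" for s
      using g(2)[of "(p, s)"] p that by (simp add: exp_eq_polar norm_mult)
    \<comment> \<open>Orbits start on the cylinder of radius 1, so the normalization does not alter
      \<open>cis\<close>.\<close>
    have f0: "f (p, 0) = cis (?w + fst p)"
      by (simp add: f_def Kmap_plane)
    then have "cis (Im (g (p, 0))) = cis (?w + fst p)"
      using polar[of 0] by simp
    then have "cis (\<Theta> p s) = cis (Im (g (p, s)))"
      by (simp add: \<Theta>_def add.assoc flip: cis_mult cis_divide)
    then show ?thesis using polar[OF s] by simp
  qed
  have angle: "angle_fun G E p = \<Theta> p 1" if p: "p \<in> R" for p
  proof -
    let ?T = "\<tau> (?K p)"
    note T = transit_time_Kmap_pos[OF p]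
    define P where "P \<theta> \<longleftrightarrow> continuous_on {0..?T} \<theta> \<and> \<theta> 0 = ?w + fst p \<and>
      (\<forall>t\<in>{0..?T}. PL (G t (?K p)) /\<^sub>R norm (PL (G t (?K p))) = vector [cos (\<theta> t), sin (\<theta> t), 0])" for \<theta>
    define \<theta> where "\<theta> t = \<Theta> p (t / ?T)" for t
    have "P \<theta>"
      unfolding P_def
    proof (intro conjI ballI)
      show "continuous_on {0..?T} \<theta>"
        unfolding \<theta>_def \<Theta>_def using T p by (intro continuous_intros g_cont) auto
      show "\<theta> 0 = ?w + fst p" by (simp add: \<theta>_def \<Theta>_def)
      fix t assume t: "t \<in> {0..?T}"
      have "f (p, t / ?T) = plane (G t (?K p))"
        using T by (simp add: f_def)
      with dir[OF p, of "t / ?T"] t T have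
        d: "plane (G t (?K p)) = norm (PL (G t (?K p))) * cis (\<theta> t)"
        by (simp add: \<theta>_def norm_plane)
      have "PL (G t (?K p)) \<noteq> 0"
        by (rule radius_pos[OF Kmap_start(1-3)[OF p] t Kmap_start(4)[OF p]])
      then show "PL (G t (?K p)) /\<^sub>R norm (PL (G t (?K p))) = vector [cos (\<theta> t), sin (\<theta> t), 0]"
        using d by (intro unit_direction)
    qed
    moreover have "\<theta>' ?T = \<theta> ?T" if "P \<theta>'" for \<theta>'
    proof (rule cis_lift_unique[where f = \<theta>' and g = \<theta>])
      show "cis (\<theta>' t) = cis (\<theta> t)" if "t \<in> {0..?T}" for t
      proof -
        have "vector [cos (\<theta>' t), sin (\<theta>' t), 0 :: real] = (vector [cos (\<theta> t), sin (\<theta> t), 0] :: real^3)"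
          using \<open>P \<theta>\<close> \<open>P \<theta>'\<close> that unfolding P_def by metis
        then show ?thesis by (simp add: vec_eq_iff forall_3 complex_eq_iff)
      qed
    qed (use \<open>P \<theta>\<close> \<open>P \<theta>'\<close> T in \<open>auto simp: P_def\<close>)
    ultimately have "(THE a. \<exists>\<theta>. P \<theta> \<and> a = \<theta> ?T) = \<theta> ?T"
      by (intro the_equality) blast+
    moreover have "angle_fun G E p = (THE a. \<exists>\<theta>. P \<theta> \<and> a = \<theta> ?T)"
      by (simp only: angle_fun_def Let_def P_def conj_assoc)
    moreover have "\<theta> ?T = \<Theta> p 1"
      using T by (simp add: \<theta>_def)
    ultimately show ?thesis by simp
  qed
  have "continuous_on R (\<lambda>p. \<Theta> p 1)"
    unfolding \<Theta>_def by (intro continuous_intros g_cont) auto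
  then show "continuous_on R (angle_fun G E)"
    by (rule continuous_on_eq) (simp add: angle)
  show "PL (inner_map G (?K p)) /\<^sub>R norm (PL (inner_map G (?K p)))
      = vector [cos (angle_fun G E p), sin (angle_fun G E p), 0]" if p: "p \<in> R" for p
  proof -
    let ?y = "inner_map G (?K p)"
    have d: "plane ?y = norm (PL ?y) * cis (\<Theta> p 1)"
      using dir[OF p, of 1] by (simp add: f_def inner_map_def norm_plane)
    have "PL ?y \<noteq> 0"
      unfolding inner_map_def using transit_time_Kmap_pos[OF p]
      by (intro radius_pos[OF Kmap_start(1-3)[OF p] _ Kmap_start(4)[OF p]]) auto
    then show ?thesis
      unfolding angle[OF p] using d by (intro unit_direction)
  qed
qed

end

end

section \<open>Exponential estimates for the inner map\<close>

context near_linear_flow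
begin

lemma MI_in_B1: "x \<in> MI \<Longrightarrow> 0 < x $ 3 \<Longrightarrow> x $ 3 < 1 \<Longrightarrow> x \<in> B1"
  by (simp add: MI_def B1_def)

text \<open>The n + 1 factors 1 - q or 1 + q are absorbed into exponentials of m (t + 1), as n \<le>
  t. The number \<open>m\<close> is kept free: \<open>ln 2\<close> always qualifies because q < 1/2,
  and \<open>m_dev\<close> gives the sharp rates.\<close>

lemma transit_exp_bounds:
  assumes x: "x \<in> MI" "0 < x $ 3" "x $ 3 < 1" and m: "1 + q \<le> exp m" "exp (- m) \<le> 1 - q"
    and t: "t = transit_time G x"
  shows "x $ 3 \<le> exp (m * (t + 1) - u * t)" "exp (- (m * (t + 1) + u * t)) \<le> x $ 3"
    "exp (\<sigma> * t - m * (t + 1)) \<le> norm (PL (inner_map G x))"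
    "norm (PL (inner_map G x)) \<le> exp (\<sigma> * t + m * (t + 1))"
    "norm (PL (inner_map G x)) \<le> exp (\<sigma> * (t - 1) / 2)"
proof -
  have "norm (PL x) = 1" using x by (simp add: MI_def)
  with transit_bounds[OF MI_in_B1[OF x] x(2,3) t] obtain n where n: "real n \<le> t"
    and b: "exp (u * t) * (1 - q) ^ Suc n * x $ 3 \<le> 1" "1 \<le> exp (u * t) * (1 + q) ^ Suc n * x $ 3"
    "exp (\<sigma> * t) * (1 - q) ^ Suc n \<le> norm (PL (inner_map G x))"
    "norm (PL (inner_map G x)) \<le> exp (\<sigma> * t) * (1 + q) ^ Suc n"
    "norm (PL (inner_map G x)) \<le> exp (\<sigma> * (t - 1) / 2)"
    by (auto simp: inner_map_def t)
  have "1 \<le> exp m" using m(1) q(1) by linarith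
  then have "0 \<le> m" by simp
  have "(1 + q) ^ Suc n \<le> exp m ^ Suc n"
    using m q by (intro power_mono) auto
  also have "\<dots> = exp (m * real (Suc n))"
    by (simp only: exp_of_nat2_mult)
  also have "\<dots> \<le> exp (m * (t + 1))"
    using n \<open>0 \<le> m\<close> by (simp add: mult_left_mono)
  finally have up: "(1 + q) ^ Suc n \<le> exp (m * (t + 1))" .
  have "exp (- (m * (t + 1))) \<le> exp (- (m * real (Suc n)))"
    using n \<open>0 \<le> m\<close> by (simp add: mult_left_mono)
  also have "\<dots> = exp (- m) ^ Suc n"
    by (simp only: exp_of_nat2_mult[symmetric] mult_minus_left)
  also have "\<dots> \<le> (1 - q) ^ Suc n"
    using m by (intro power_mono) auto
  finally have down: "exp (- (m * (t + 1))) \<le> (1 - q) ^ Suc n" .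
  have "exp (u * t) * exp (- (m * (t + 1))) * x $ 3 \<le> exp (u * t) * (1 - q) ^ Suc n * x $ 3"
    using down x by (intro mult_right_mono mult_left_mono) auto
  with b(1) have "exp (u * t) * exp (- (m * (t + 1))) * x $ 3 \<le> 1" by linarith
  then show "x $ 3 \<le> exp (m * (t + 1) - u * t)"
    by (simp add: exp_minus exp_diff exp_add field_simps)
  have "exp (u * t) * (1 + q) ^ Suc n * x $ 3 \<le> exp (u * t) * exp (m * (t + 1)) * x $ 3"
    using up x by (intro mult_right_mono mult_left_mono) auto
  with b(2) have "1 \<le> exp (u * t) * exp (m * (t + 1)) * x $ 3" by linarith
  then show "exp (- (m * (t + 1) + u * t)) \<le> x $ 3"
    by (simp add: exp_minus exp_diff exp_add field_simps)
  have "exp (\<sigma> * t) * exp (- (m * (t + 1))) \<le> exp (\<sigma> * t) * (1 - q) ^ Suc n"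
    using down by simp
  with b(3) show "exp (\<sigma> * t - m * (t + 1)) \<le> norm (PL (inner_map G x))"
    by (simp add: mult_exp_exp)
  have "exp (\<sigma> * t) * (1 + q) ^ Suc n \<le> exp (\<sigma> * t) * exp (m * (t + 1))"
    using up by simp
  with b(4) show "norm (PL (inner_map G x)) \<le> exp (\<sigma> * t + m * (t + 1))"
    by (simp add: mult_exp_exp)
  show "norm (PL (inner_map G x)) \<le> exp (\<sigma> * (t - 1) / 2)"
    by (rule b)
qed

text \<open>The crude choice m = ln 2 is the origin of \<open>u + ln 2\<close> in the smallness
  conditions.\<close>

lemma transit_time_lower_bound:
  assumes x: "x \<in> MI" "0 < x $ 3" "x $ 3 < 1"
  shows "ln (1 / x $ 3) / (u + ln 2) - 1 \<le> transit_time G x"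
proof -
  have "exp (- (ln 2 * (\<tau> x + 1) + u * \<tau> x)) \<le> x $ 3"
    using q by (intro transit_exp_bounds(2)[OF x]) (simp_all add: exp_minus)
  then have "ln (exp (- (ln 2 * (\<tau> x + 1) + u * \<tau> x))) \<le> ln (x $ 3)"
    using x(2) by (subst ln_le_cancel_iff) auto
  then have "ln (1 / x $ 3) \<le> ln 2 * (\<tau> x + 1) + u * \<tau> x"
    using x(2) by (simp add: ln_div)
  also have "\<dots> \<le> (\<tau> x + 1) * (u + ln 2)"
    using rates by (simp add: algebra_simps)
  finally show ?thesis
    using rates by (simp add: pos_divide_le_eq diff_le_eq add_pos_pos)
qed

text \<open>The crude radius bound exp (\<sigma> (t - 1) / 2) is below \<open>r\<close> exactly if t
  > 1 + 2 / \<sigma> ln r, and the hypothesis forces the transit time beyond this.\<close>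

lemma inner_map_in_ME:
  assumes x: "x \<in> MI" "0 < x $ 3" "x $ 3 < 1" and "0 < r"
    and r: "1 + 2 / \<sigma> * ln r < ln (1 / x $ 3) / (u + ln 2) - 1"
  shows "inner_map G x \<in> ME r"
proof -
  have "2 / \<sigma> * ln r < \<tau> x - 1"
    using r transit_time_lower_bound[OF x] by linarith
  then have "(\<sigma> / 2) * (\<tau> x - 1) < (\<sigma> / 2) * (2 / \<sigma> * ln r)"
    using rates by (intro mult_strict_left_mono_neg) auto
  then have "\<sigma> * (\<tau> x - 1) / 2 < ln r"
    using rates by simp
  then have "exp (\<sigma> * (\<tau> x - 1) / 2) < exp (ln r)"
    by (simp only: exp_less_cancel_iff)
  moreover have "norm (PL (inner_map G x)) \<le> exp (\<sigma> * (\<tau> x - 1) / 2)"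
    using q by (intro transit_exp_bounds(5)[OF x, of "ln 2"]) (simp_all add: exp_minus)
  moreover have "inner_map G x $ 3 = 1"
    using is_transit_transit_time[OF MI_in_B1[OF x] x(2,3)] by (simp add: is_transit_def inner_map_def)
  ultimately show ?thesis using \<open>0 < r\<close> by (simp add: ME_iff)
qed

text \<open>The hypothesis \<open>small\<close> makes the transit time t exceed m / (\<eta>' - m),
  that is, m (t + 1) < \<eta>' t: the accumulated error amounts to a change of the rates by \<eta>'.
  So t lies between ln (1 / x3) divided by u + \<eta>' and by u - \<eta>', where x3 is the initial
  height. The upper time bound gives the lower radius bound. For the upper radius bound, \<eta>' < -
  \<sigma> / 2 < u / 2 allows 3 u / 2 for u + \<eta>' and \<sigma> / 2 for \<sigma> + \<eta>', which
  yields the exponent - \<sigma> / (3 u).\<close>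

lemma inner_map_radius:
  assumes x: "x \<in> MI" "0 < x $ 3" "x $ 3 < 1" and m: "1 + q \<le> exp m" "exp (- m) \<le> 1 - q"
    and \<eta>': "m < \<eta>'" "\<eta>' < - \<sigma> / 2"
    and small: "m / (\<eta>' - m) < ln (1 / x $ 3) / (u + ln 2) - 1"
  shows "norm (PL (inner_map G x)) \<le> x $ 3 powr (- \<sigma> / (3 * u))"
    "x $ 3 powr ((- \<sigma> + \<eta>') / (u - \<eta>')) \<le> norm (PL (inner_map G x))"
proof -
  let ?t = "\<tau> x" and ?l = "ln (1 / x $ 3)"
  have "1 \<le> exp m" using m(1) q(1) by linarith
  then have "0 \<le> m" by simp
  have \<eta>'_pos: "0 < \<eta>'" "\<eta>' < u" "u + \<eta>' \<le> 3 * u / 2" "\<sigma> + \<eta>' \<le> \<sigma> / 2"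
    using \<open>0 \<le> m\<close> \<eta>' rates by auto
  have "m / (\<eta>' - m) < ?t"
    using small transit_time_lower_bound[OF x] by linarith
  then have mt: "m * (?t + 1) \<le> \<eta>' * ?t"
    using \<eta>' by (simp add: pos_divide_less_eq algebra_simps)
  have "0 < ?t"
    using is_transit_transit_time[OF MI_in_B1[OF x] x(2,3)] by (simp add: is_transit_def)
  have l: "x $ 3 = exp (- ?l)" "0 < ?l"
    using x by (simp_all add: ln_div)
  note b = transit_exp_bounds[OF x m refl]
  have "exp (- ?l) \<le> exp (m * (?t + 1) - u * ?t)"
    using b(1) l(1) by simp
  then have "(u - \<eta>') * ?t \<le> ?l"
    using mt unfolding exp_le_cancel_iff left_diff_distrib by linarith
  then have t_up: "?t \<le> ?l / (u - \<eta>')"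
    using \<eta>'_pos by (simp add: pos_le_divide_eq mult.commute)
  have "exp (- (m * (?t + 1) + u * ?t)) \<le> exp (- ?l)"
    using b(2) l(1) by simp
  then have "?l \<le> (u + \<eta>') * ?t"
    using mt unfolding exp_le_cancel_iff distrib_right by linarith
  also have "\<dots> \<le> (3 * u / 2) * ?t"
    using \<eta>'_pos \<open>0 < ?t\<close> by (intro mult_right_mono) auto
  finally have t_low: "2 * ?l / (3 * u) \<le> ?t"
    using rates by (simp add: pos_divide_le_eq field_simps)
  have "\<sigma> * ?t + m * (?t + 1) \<le> (\<sigma> + \<eta>') * ?t"
    using mt by (simp add: distrib_right)
  also have "\<dots> \<le> (\<sigma> / 2) * ?t"
    using \<eta>'_pos \<open>0 < ?t\<close> by (intro mult_right_mono) auto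
  also have "\<dots> \<le> (\<sigma> / 2) * (2 * ?l / (3 * u))"
    using t_low rates by (intro mult_left_mono_neg) auto
  also have "\<dots> = - \<sigma> / (3 * u) * - ?l"
    by simp
  finally have "exp (\<sigma> * ?t + m * (?t + 1)) \<le> exp (- \<sigma> / (3 * u) * - ?l)"
    by (simp only: exp_le_cancel_iff)
  also have "\<dots> = x $ 3 powr (- \<sigma> / (3 * u))"
    using x by (simp add: powr_def ln_div)
  finally show "norm (PL (inner_map G x)) \<le> x $ 3 powr (- \<sigma> / (3 * u))"
    using b(4) by linarith
  have numerator: "(- \<sigma> + \<eta>') * - ?l = (\<sigma> - \<eta>') * ?l"
    by (simp add: algebra_simps)
  have "(- \<sigma> + \<eta>') / (u - \<eta>') * - ?l = (\<sigma> - \<eta>') * (?l / (u - \<eta>'))"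
    unfolding times_divide_eq_left times_divide_eq_right numerator ..
  also have "\<dots> \<le> (\<sigma> - \<eta>') * ?t"
    using t_up rates \<eta>'_pos by (intro mult_left_mono_neg) auto
  also have "\<dots> \<le> \<sigma> * ?t - m * (?t + 1)"
    using mt by (simp add: left_diff_distrib)
  finally have "exp ((- \<sigma> + \<eta>') / (u - \<eta>') * - ?l) \<le> exp (\<sigma> * ?t - m * (?t + 1))"
    by (simp only: exp_le_cancel_iff)
  moreover have "x $ 3 powr ((- \<sigma> + \<eta>') / (u - \<eta>')) = exp ((- \<sigma> + \<eta>') / (u - \<eta>') * - ?l)"
    using x by (simp add: powr_def ln_div)
  ultimately show "x $ 3 powr ((- \<sigma> + \<eta>') / (u - \<eta>')) \<le> norm (PL (inner_map G x))"
    using b(3) by linarith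
qed

end

section \<open>Itineraries of the return map\<close>

lemma m_dev_bounds:
  assumes "0 < \<eta>" "\<eta> < exp \<sigma> / 2"
  shows "1 + \<eta> * exp (- \<sigma>) \<le> exp (m_dev \<eta> \<sigma>)" "exp (- m_dev \<eta> \<sigma>) \<le> 1 - \<eta> * exp (- \<sigma>)"
proof -
  have q: "0 < \<eta> * exp (- \<sigma>)" "\<eta> * exp (- \<sigma>) < 1"
    using assms by (auto simp: exp_minus field_simps intro: less_trans[of _ "exp \<sigma> / 2"])
  have "ln (1 + \<eta> * exp (- \<sigma>)) \<le> m_dev \<eta> \<sigma>"
    by (simp add: m_dev_def)
  then have "exp (ln (1 + \<eta> * exp (- \<sigma>))) \<le> exp (m_dev \<eta> \<sigma>)"
    by (simp only: exp_le_cancel_iff)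
  then show "1 + \<eta> * exp (- \<sigma>) \<le> exp (m_dev \<eta> \<sigma>)"
    using q by (simp add: add_pos_pos)
  have "ln (1 / (1 - \<eta> * exp (- \<sigma>))) \<le> m_dev \<eta> \<sigma>"
    by (simp add: m_dev_def)
  then have "- m_dev \<eta> \<sigma> \<le> ln (1 - \<eta> * exp (- \<sigma>))"
    using q by (simp add: ln_div)
  then have "exp (- m_dev \<eta> \<sigma>) \<le> exp (ln (1 - \<eta> * exp (- \<sigma>)))"
    by (simp only: exp_le_cancel_iff)
  then show "exp (- m_dev \<eta> \<sigma>) \<le> 1 - \<eta> * exp (- \<sigma>)"
    using q by simp
qed

theorem theorem8p2:
  fixes \<sigma> \<mu> u tU tL \<epsilon>B :: real
    and F :: "real \<Rightarrow> real^3 \<Rightarrow> real^3" and h :: "real \<Rightarrow> real^3"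
    and \<epsilon>\<eta> tE :: "real \<Rightarrow> real"
    and tI \<epsilon> r :: "nat \<Rightarrow> real" and T :: "nat \<Rightarrow> real^3 \<Rightarrow> real"
    and \<eta>' \<eta> \<delta>' \<delta> c k \<beta> \<alpha> \<delta>\<beta> \<Delta>1 \<Delta>2 m1 m2 \<psi> :: real and j :: nat
    and v w :: "real^3" and E :: "real^3 \<Rightarrow> real^3" and \<Phi> :: "real \<times> real \<Rightarrow> real"
  assumes params: "\<sigma> < 0" "0 < \<mu>" "0 < u" "0 < \<sigma> + u"
    \<comment> \<open>the flow and the homoclinic flowline\<close>
    and flow: "is_flow F" "C1_on (\<lambda>(t, x). F t x) UNIV"
    and origin: "arises_from_homoclinic_vectorfield \<sigma> \<mu> u F"
    and flowline: "\<forall>t s. h (t + s) = F t (h s)"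
    and F1: "\<forall>t. F t 0 = 0"
    and F2: "\<forall>t. h t \<noteq> 0 \<and> vector_derivative h (at t) \<noteq> 0" "(h \<longlongrightarrow> 0) at_top" "(h \<longlongrightarrow> 0) at_bot"
    and F3: "\<forall>t. D2 F t 0 ` Lspace \<subseteq> Lspace \<and> D2 F t 0 ` Uspace \<subseteq> Uspace"
      "\<forall>t x. D2 F t 0 x = vector [exp (\<sigma> * t) * (cos (\<mu> * t) * x $ 1 + sin (\<mu> * t) * x $ 2),
                                 exp (\<sigma> * t) * (- sin (\<mu> * t) * x $ 1 + cos (\<mu> * t) * x $ 2),
                                 exp (u * t) * x $ 3]"
    and F4: "\<exists>rF>0. invariant_in Lspace F {x. norm x < rF} \<and> invariant_in Uspace F {x. norm x < rF}"
    and F5: "tU < tL" "\<forall>t\<le>tU. \<exists>a>0. h t = a *\<^sub>R e3" "\<forall>t\<ge>tL. h t \<in> Lspace"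
    \<comment> \<open>admissible scaling parameters\<close>
    and eps_eta: "\<forall>\<eta>>0. 0 < \<epsilon>\<eta> \<eta> \<and> (\<forall>e t x. 0 < e \<and> e < \<epsilon>\<eta> \<eta> \<and> t \<in> {0..1} \<and> x \<in> B1
                    \<longrightarrow> onorm (\<lambda>y. D2 (scaled F e) t x y - D2 F t 0 y) < \<eta>)"
    and eps_B: "0 < \<epsilon>B" "\<forall>e. 0 < e \<and> e < \<epsilon>B \<longrightarrow>
                    (\<forall>t\<in>{0..1}. scaled F e t ` B1 \<subseteq> cball 0 (rB F u)) \<and>
                    invariant_in Lspace (scaled F e) (cball 0 (rB F u)) \<and>
                    invariant_in Uspace (scaled F e) (cball 0 (rB F u))"
    \<comment> \<open>the data for the exterior maps, for all indices \<open>i \<ge> 1\<close>\<close>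
    and tE: "\<forall>e. 0 < e \<and> e < norm (h tU) \<longrightarrow> tE e \<le> tU \<and> (1 / e) *\<^sub>R h (tE e) = e3"
    and tI: "strict_mono_on {1..} tI" "\<forall>i\<ge>1. tL \<le> tI i" "filterlim tI at_top sequentially"
    and eps: "strict_antimono_on {1..} \<epsilon>" "\<forall>i\<ge>1. 0 < \<epsilon> i \<and> \<epsilon> i < norm (h tU)" "\<epsilon> \<longlonglongrightarrow> 0"
    and entry: "\<forall>i\<ge>1. norm ((1 / \<epsilon> i) *\<^sub>R h (tI i)) = 1 \<and>
                  deriv (\<lambda>t. (norm ((1 / \<epsilon> i) *\<^sub>R h t))\<^sup>2) (tI i) < 0 \<and>
                  (\<forall>t\<ge>tI i. (1 / \<epsilon> i) *\<^sub>R h t \<in> Lspace)"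
    and r: "antimono_on {1..} r" "\<forall>i\<ge>1. 0 < r i" "r \<longlonglongrightarrow> 0"
    and T: "\<forall>i\<ge>1. C1_on (T i) (ME (r i)) \<and> T i e3 = tI i - tE (\<epsilon> i) \<and>
              (\<forall>y\<in>ME (r i). 0 < T i y \<and>
                 scaled F (\<epsilon> i) (T i y) y \<in> {z \<in> MI. PL z \<noteq> - ((1 / \<epsilon> i) *\<^sub>R h (tI i))} \<and>
                 vector_derivative (\<lambda>t. scaled F (\<epsilon> i) t y) (at 0) \<notin> Lspace)"
    \<comment> \<open>the choices\<close>
    and eta': "0 < \<eta>'" "\<eta>' < min \<mu> (- \<sigma> / 2)"
    and c: "c = ((u + \<eta>') * (\<mu> + \<eta>')) / ((u - \<eta>') * (\<mu> - \<eta>'))"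
    and k: "k = exp (- 6 * pi * ((u + \<eta>') / (\<mu> - \<eta>')))"
    and c_less: "c * ((- \<sigma> + \<eta>') / (u - \<eta>')) < 1"
    and j: "1 \<le> j"
    and C: "smallness_conditions \<sigma> u \<epsilon>\<eta> \<epsilon>B (\<epsilon> j) (r j) \<eta>' \<eta> \<delta>' \<delta>"
    and E: "E = exterior_map (scaled F (\<epsilon> j)) (T j)"
    and vw: "v \<in> Lspace" "w \<in> Lspace"
      "tangent_e3 (Kinv E \<circ> E) v = (1, 0)" "tangent_e3 (Kinv E \<circ> E) w = (0, 1)"
    and beta: "0 < \<beta>" "\<beta> \<le> 1 / 2"
    and alpha: "admissible_alpha E (r j) v w \<beta> \<alpha>" "\<alpha> < \<delta>"
    and delta_beta: "\<delta>\<beta> = (2 / (3 * (kappa_norm v w + 1)) * \<alpha>) powr (3 * u / (- \<sigma>))"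
    and Delta2: "0 < \<Delta>2" "\<Delta>2 < \<delta>\<beta>"
      "2 * sqrt 2 * \<Delta>2 < 1 / onorm (kappa_inv v w) * k powr ((- \<sigma> + \<eta>') / (u - \<eta>'))
                           * \<Delta>2 powr (c * ((- \<sigma> + \<eta>') / (u - \<eta>')))"
    and Delta1: "\<Delta>1 = k * \<Delta>2 powr c"
    and Phi: "\<Phi> = angle_fun (scaled F (\<epsilon> j)) E"
    and m1: "m1 = (SUP \<gamma>\<in>{-\<alpha>..\<alpha>}. \<Phi> (\<gamma>, \<Delta>1))"
    and m2: "m2 = (INF \<gamma>\<in>{-\<alpha>..\<alpha>}. \<Phi> (\<gamma>, \<Delta>2))"
    and psi: "\<psi> \<in> {m1 + pi..m2 - pi}" "vector [cos \<psi>, sin \<psi>, 0] = w /\<^sub>R norm w"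
  shows "\<forall>s :: int \<Rightarrow> nat. range s \<subseteq> {0, 1} \<longrightarrow>
           (\<exists>y :: int \<Rightarrow> real \<times> real. \<forall>n.
              y (n + 1) = return_map (scaled F (\<epsilon> j)) E (y n) \<and>
              y n \<in> (if s n = 0 then M0 \<Phi> \<alpha> \<Delta>1 \<Delta>2 \<psi> else M1 \<Phi> \<alpha> \<Delta>1 \<Delta>2 \<psi>))"
proof (intro allI impI)
  fix s :: "int \<Rightarrow> nat"
  assume s: "range s \<subseteq> {0, 1}"
  note C1_flow = flow(2)
  define e where "e = \<epsilon> j"
  define G where "G = scaled F e"
  \<comment> \<open>The one-step error \<eta> relative to \<open>exp \<sigma>\<close>, the smallest
    linear factor over a unit of time.\<close>
  define q where "q = \<eta> * exp (- \<sigma>)"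
  define m where "m = m_dev \<eta> \<sigma>"
  define X where "X = (- \<sigma> + \<eta>') / (u - \<eta>')"
  let ?R = "{-\<alpha>..\<alpha>} \<times> {\<Delta>1..\<Delta>2}"
  have e: "0 < e" "e < norm (h tU)" using eps(2) j by (auto simp: e_def)
  have r_pos: "0 < r j" using r(2) j by simp
  have smallness: "0 < \<eta>" "\<eta> < exp \<sigma> / 2" "1 + q < exp (- \<sigma> / 2)" "m < \<eta>'" "e < \<epsilon>\<eta> \<eta>" "e < \<epsilon>B"
    "0 < \<delta>'" "\<delta>' < 1" "1 + 2 / \<sigma> * ln (r j) < ln (1 / \<delta>') / (u + ln 2) - 1"
    "0 < \<delta>" "\<delta> < \<delta>'" "m / (\<eta>' - m) < ln (1 / \<delta>) / (u + ln 2) - 1"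
    using C by (auto simp: smallness_conditions_def q_def m_def e_def)
  have q: "0 < q" "q < 1 / 2" "q * exp \<sigma> = \<eta>"
    using smallness(1,2) by (auto simp: q_def exp_minus field_simps)
  have m: "1 + q \<le> exp m" "exp (- m) \<le> 1 - q"
    using m_dev_bounds[OF smallness(1,2)] by (auto simp: q_def m_def)
  interpret near_linear_flow G \<sigma> u q
  proof
    show "is_flow G" using flow(1) e by (simp add: G_def is_flow_scaled)
    show "continuous_on UNIV (\<lambda>(t, x). G t x)"
      unfolding G_def by (rule continuous_scaled[OF C1_flow])
    fix x t assume x: "x \<in> B1" and t: "t \<in> {0..(1::real)}"
    have step: "\<bar>scaled F e t x $ 3 - exp (u * t) * x $ 3\<bar> \<le> \<eta> * \<bar>x $ 3\<bar>"
      "\<bar>norm (PL (scaled F e t x)) - exp (\<sigma> * t) * norm (PL x)\<bar> \<le> \<eta> * norm (PL x)"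
    proof -
      have "onorm (\<lambda>y. D2 (scaled F e) t z y - D2 F t 0 y) < \<eta>" if "z \<in> B1" for z
        using eps_eta smallness(1,5) e(1) t that by blast
      moreover have "scaled F e t ` B1 \<subseteq> cball 0 (rB F u)" if "t \<in> {0..1}" for t
        using eps_B(2) smallness(6) e(1) that by blast
      moreover have "invariant_in Lspace (scaled F e) (cball 0 (rB F u))"
        "invariant_in Uspace (scaled F e) (cball 0 (rB F u))"
        using eps_B(2) smallness(6) e(1) by blast+
      ultimately show "\<bar>scaled F e t x $ 3 - exp (u * t) * x $ 3\<bar> \<le> \<eta> * \<bar>x $ 3\<bar>"
        "\<bar>norm (PL (scaled F e t x)) - exp (\<sigma> * t) * norm (PL x)\<bar> \<le> \<eta> * norm (PL x)"
        using one_step_bounds_spiral[OF C1_flow flow(1) e(1) t x F3(2)[rule_format]] by blast+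
    qed
    then show "\<bar>G t x $ 3 - exp (u * t) * x $ 3\<bar> \<le> q * exp \<sigma> * \<bar>x $ 3\<bar>"
      "\<bar>norm (PL (G t x)) - exp (\<sigma> * t) * norm (PL x)\<bar> \<le> q * exp \<sigma> * norm (PL x)"
      unfolding G_def q(3) by auto
  qed (use params q smallness in auto)

  have E': "E y = G (T j y) y" for y
    by (simp add: E exterior_map_def G_def e_def)
  have E_e3: "E e3 = (1 / e) *\<^sub>R h (tI j)"
  proof -
    have "(1 / e) *\<^sub>R h (tE e) = e3" using tE e by blast
    then have "e *\<^sub>R e3 = h (tE e)" using e(1) by (metis divide_self_if less_irrefl scaleR_one scaleR_scaleR times_divide_eq_right mult.right_neutral)
    moreover have "T j e3 = tI j - tE e" using T j by (simp add: e_def)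
    ultimately show ?thesis
      using flowline[rule_format, of "tI j - tE e" "tE e"] by (simp add: E' G_def scaled_def)
  qed
  then have E_base: "E e3 \<in> Lspace" "norm (E e3) = 1"
    using entry j by (auto simp: e_def)
  have E_range: "E y \<in> MI \<and> PL (E y) \<noteq> - E e3" if "y \<in> ME (r j)" for y
    unfolding E_e3 using T j that by (auto simp: E' G_def e_def)
  have T_C1: "C1_on (T j) (ME (r j))" using T j by blast
  have cont_KE: "continuous_on (ME (r j)) (Kinv E \<circ> E)"
  proof (rule continuous_on_compose)
    have "continuous_on (ME (r j)) (\<lambda>y. G (T j y) y)"
      by (intro continuous_flow C1_on_imp_continuous_on[OF T_C1] continuous_on_id)
    then show "continuous_on (ME (r j)) E"
      unfolding E' .
    show "continuous_on (E ` ME (r j)) (Kinv E)"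
      by (rule continuous_on_subset[OF continuous_on_Kinv[of E, OF E_base]]) (use E_range in auto)
  qed

  \<comment> \<open>\<open>tangent_e3\<close> is a \<open>frechet_derivative\<close>, whose
    linearity is known only after differentiability of the exterior map in coordinates has been
    shown. Independence of \<open>v\<close> and \<open>w\<close> then follows from their
    images.\<close>
  have det: "det2 v w \<noteq> 0"
  proof (rule det2_nonzero[OF _ vw])
    let ?U = "{x :: real^3. norm (PL x) < r j}"
    have "(\<lambda>x. e3 + PL x) differentiable (at 0)"
      by (auto simp: differentiable_def intro!: derivative_eq_intros bounded_linear_imp_has_derivative bounded_linear_PL)
    then have "(\<lambda>x. E (e3 + PL x)) differentiable (at 0)"
      unfolding E' G_def
      by (intro scaled_differentiable_compose[OF C1_flow] C1_on_ME_differentiable[OF T_C1 r_pos])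
    moreover have "open ?U" "0 \<in> ?U"
      using r_pos linear_0[OF linear_PL] by (auto intro!: open_Collect_less continuous_intros)
    moreover have "E (e3 + PL x) \<in> MI \<and> PL (E (e3 + PL x)) \<noteq> - E e3" if "x \<in> ?U" for x
      using that by (intro E_range) (simp add: ME_iff)
    ultimately have "(\<lambda>x. Kinv E (E (e3 + PL x))) differentiable (at 0)"
      by (rule Kinv_differentiable_compose[of E, OF E_base])
    then have "linear (frechet_derivative (\<lambda>x. Kinv E (E (e3 + PL x))) (at 0))"
      by (rule linear_frechet_derivative)
    then show "linear (tangent_e3 (Kinv E \<circ> E))"
      by (simp add: tangent_e3_def)
  qed
  note kappa_rules = vw(1,2) det
  have "w \<noteq> 0" using det by (auto simp: det2_def)

  have \<alpha>: "0 < \<alpha>" "\<alpha> < 1" "\<alpha> < \<delta>"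
    and \<alpha>_approx: "\<And>p. p \<in> {-\<alpha>..\<alpha>} \<times> {-\<alpha>..\<alpha>} \<Longrightarrow>
      norm (exterior_in_coordinates E (r j) v w p - p) \<le> \<beta> * norm p"
    using alpha smallness by (auto simp: admissible_alpha_def)
  let ?kn = "kappa_norm v w"
  have kn: "0 \<le> ?kn" by (rule kappa_norm_nonneg[OF kappa_rules])
  \<comment> \<open>A radius up to \<alpha>' has coordinates of norm at most 2/3 \<alpha>, and
    \<delta>\<beta> is the height at which the upper radius bound equals \<alpha>'.\<close>
  define \<alpha>' where "\<alpha>' = 2 / (3 * (?kn + 1)) * \<alpha>"
  have \<alpha>'_bounds: "0 < \<alpha>'" "\<alpha>' < \<alpha>" "?kn * \<alpha>' \<le> 2 / 3 * \<alpha>"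
  proof -
    have "0 < 3 * (?kn + 1)" using kn by simp
    then have "0 < 2 / (3 * (?kn + 1))" "2 / (3 * (?kn + 1)) < 1" "?kn * (2 / (3 * (?kn + 1))) \<le> 2 / 3"
      using kn by (simp_all add: pos_divide_less_eq pos_divide_le_eq)
    from mult_pos_pos[OF this(1) \<alpha>(1)] mult_strict_right_mono[OF this(2) \<alpha>(1)]
      mult_right_mono[OF this(3) less_imp_le[OF \<alpha>(1)]]
    show "0 < \<alpha>'" "\<alpha>' < \<alpha>" "?kn * \<alpha>' \<le> 2 / 3 * \<alpha>"
      by (simp_all add: \<alpha>'_def)
  qed
  have \<delta>\<beta>_less: "\<delta>\<beta> < \<delta>"
  proof -
    have "\<delta>\<beta> \<le> \<alpha>' powr 1"
      unfolding delta_beta \<alpha>'_def[symmetric] using \<alpha>'_bounds \<alpha> params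
      by (intro powr_mono') (auto simp: field_simps)
    then show ?thesis using \<alpha>'_bounds \<alpha> by simp
  qed
  have \<Delta>2: "\<Delta>2 < \<delta>" "\<Delta>2 < 1" using \<delta>\<beta>_less Delta2 smallness by auto
  have \<eta>': "0 < \<eta>'" "\<eta>' < \<mu>" "\<eta>' < - \<sigma> / 2" "\<eta>' < u" using eta' params by auto
  have X_pos: "0 < X" using \<eta>' params by (simp add: X_def)
  have "k < 1" "0 < k" using \<eta>' params by (auto simp: k)
  have "1 \<le> c"
    unfolding c using \<eta>' params by (simp add: pos_le_divide_eq) (intro mult_mono, auto)
  have "\<Delta>2 powr c \<le> \<Delta>2 powr 1"
    using \<open>1 \<le> c\<close> Delta2(1) \<Delta>2 by (intro powr_mono') auto
  then have \<Delta>1: "\<Delta>1 < \<Delta>2" "0 < \<Delta>1"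
    using \<open>k < 1\<close> \<open>0 < k\<close> Delta2(1) unfolding Delta1
    by (auto intro: le_less_trans[OF mult_left_mono] simp: less_imp_le)

  have height: "0 < snd p" "snd p < \<delta>" "snd p < 1" "\<Delta>1 \<le> snd p" "snd p \<le> \<Delta>2" if "p \<in> ?R" for p
    using that \<Delta>1 \<Delta>2 by (auto simp: mem_Times_iff)
  have small_height: "ln (1 / \<delta>') / (u + ln 2) - 1 \<le> ln (1 / snd p) / (u + ln 2) - 1"
    "ln (1 / \<delta>) / (u + ln 2) - 1 \<le> ln (1 / snd p) / (u + ln 2) - 1" if "p \<in> ?R" for p
  proof -
    have "1 / \<delta>' \<le> 1 / snd p" "1 / \<delta> \<le> 1 / snd p"
      using height[OF that] smallness by (auto intro: divide_left_mono)
    then have "ln (1 / \<delta>') \<le> ln (1 / snd p)" "ln (1 / \<delta>) \<le> ln (1 / snd p)"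
      using height[OF that] smallness by (auto intro!: ln_mono)
    then show "ln (1 / \<delta>') / (u + ln 2) - 1 \<le> ln (1 / snd p) / (u + ln 2) - 1"
      "ln (1 / \<delta>) / (u + ln 2) - 1 \<le> ln (1 / snd p) / (u + ln 2) - 1"
      using params by (auto intro!: divide_right_mono add_nonneg_nonneg)
  qed
  have K: "Kmap E p \<in> MI" "0 < Kmap E p $ 3" "Kmap E p $ 3 < 1" if "p \<in> ?R" for p
    using height[OF that] by (auto simp: Kmap_plane)
  have in_ME: "inner_map G (Kmap E p) \<in> ME (r j)" if "p \<in> ?R" for p
    using smallness(9) small_height(1)[OF that]
    by (intro inner_map_in_ME[OF K[OF that] r_pos]) (simp add: Kmap_plane)
  have radius: "norm (PL (inner_map G (Kmap E p))) \<le> snd p powr (- \<sigma> / (3 * u))"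
    "snd p powr X \<le> norm (PL (inner_map G (Kmap E p)))" if "p \<in> ?R" for p
    using inner_map_radius[OF K[OF that] m smallness(4) \<eta>'(3)] smallness(12) small_height(2)[OF that]
    by (auto simp: Kmap_plane X_def)

  have cont_\<tau>: "continuous_on (Kmap E ` ?R) (transit_time G)"
  proof (rule continuous_on_transit_time)
    show "Kmap E ` ?R \<subseteq> {x \<in> B1. 0 < x $ 3 \<and> x $ 3 < 1}"
      using K MI_in_B1 by blast
    fix x assume "x \<in> Kmap E ` ?R"
    then have "inner_map G x \<in> ME (r j)" (is "?y \<in> _") using in_ME by blast
    \<comment> \<open>The exit point lies in the domain of \<open>T j\<close>, where the flow is
      transversal to the horizontal plane; so the height has a nonzero derivative at the
      exit.\<close>
    let ?d = "vector_derivative (\<lambda>t. G t ?y) (at 0)"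
    have "?d \<notin> Lspace"
      using T j \<open>?y \<in> ME (r j)\<close> by (simp add: G_def e_def)
    moreover have "(\<lambda>t. G t ?y) differentiable (at 0)"
      unfolding G_def by (intro scaled_differentiable_compose[OF C1_flow]) auto
    then have "((\<lambda>t. G t ?y) has_vector_derivative ?d) (at 0)"
      by (simp add: vector_derivative_works)
    then have "((\<lambda>t. G t ?y $ 3) has_vector_derivative ?d $ 3) (at 0)"
      by (rule bounded_linear.has_vector_derivative[OF bounded_linear_vec_nth])
    ultimately show "\<exists>d. ((\<lambda>t. G t ?y $ 3) has_real_derivative d) (at 0) \<and> d \<noteq> 0"
      by (auto simp: Lspace_iff has_real_derivative_iff_has_vector_derivative)
  qed
  have convR: "convex ?R" "\<And>p. p \<in> ?R \<Longrightarrow> 0 < snd p \<and> snd p < 1"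
    using height by (auto intro!: convex_Times)
  have \<Phi>: "\<Phi> = angle_fun G E" by (simp add: Phi G_def e_def)
  have cont_\<Phi>: "continuous_on ?R \<Phi>"
    unfolding \<Phi> by (rule angle_fun_continuous_and_exact(1)[OF convR cont_\<tau>])
  have direction: "PL (inner_map G (Kmap E p)) /\<^sub>R norm (PL (inner_map G (Kmap E p)))
      = vector [cos (\<Phi> p), sin (\<Phi> p), 0]" if "p \<in> ?R" for p
    unfolding \<Phi> by (rule angle_fun_continuous_and_exact(2)[OF convR cont_\<tau> that])

  define Q where "Q = return_map G E"
  have cont_Q: "continuous_on ?R Q"
  proof -
    have "continuous_on ?R (inner_map G \<circ> Kmap E)"
      by (intro continuous_on_compose continuous_on_Kmap continuous_on_inner_map cont_\<tau>)
    then have "continuous_on ?R ((Kinv E \<circ> E) \<circ> (inner_map G \<circ> Kmap E))"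
      by (rule continuous_on_compose) (rule continuous_on_subset[OF cont_KE], use in_ME in auto)
    then show ?thesis by (simp add: Q_def return_map_def comp_assoc)
  qed
  \<comment> \<open>The exit point in the coordinates of \<open>v\<close> and \<open>w\<close>:
    \<open>Q p\<close> is the image of \<open>z p\<close> under the exterior map in coordinates. A
    norm up to 2/3 \<alpha> plus an error of half of it stays within \<alpha>, which gives
    \<open>width\<close>.\<close>
  define z where "z p = kappa v w (PL (inner_map G (Kmap E p)))" for p
  have Q_near: "norm (Q p - z p) \<le> norm (z p) / 2" "norm (z p) \<le> 2 / 3 * \<alpha>" if "p \<in> ?R" for p
  proof -
    have "0 \<le> - \<sigma> / (3 * u)" using params by (intro divide_nonneg_nonneg) auto
    then have "snd p powr (- \<sigma> / (3 * u)) \<le> \<delta>\<beta> powr (- \<sigma> / (3 * u))"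
      using height[OF that] Delta2(2) by (intro powr_mono2) auto
    also have "\<dots> = \<alpha>'"
      using \<alpha>'_bounds params unfolding delta_beta \<alpha>'_def[symmetric] powr_powr by simp
    finally have "norm (PL (inner_map G (Kmap E p))) \<le> \<alpha>'"
      using radius(1)[OF that] by linarith
    then have "?kn * norm (PL (inner_map G (Kmap E p))) \<le> ?kn * \<alpha>'"
      using kn by (rule mult_left_mono)
    then show z_le: "norm (z p) \<le> 2 / 3 * \<alpha>"
      using norm_kappa_PL_le[OF kappa_rules, of "inner_map G (Kmap E p)"] \<alpha>'_bounds(3)
      unfolding z_def by linarith
    have "\<bar>fst (z p)\<bar> \<le> \<alpha>" "\<bar>snd (z p)\<bar> \<le> \<alpha>"
      using z_le norm_fst_le[of "fst (z p)" "snd (z p)"] norm_snd_le[of "snd (z p)" "fst (z p)"] \<alpha>(1)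
      by auto
    then have "z p \<in> {-\<alpha>..\<alpha>} \<times> {-\<alpha>..\<alpha>}"
      by (auto simp: mem_Times_iff)
    from \<alpha>_approx[OF this] have "norm (Q p - z p) \<le> \<beta> * norm (z p)"
      unfolding z_def exterior_in_coordinates_Pmap[OF kappa_rules in_ME[OF that]]
      by (simp add: Q_def return_map_def)
    also have "\<dots> \<le> 1 / 2 * norm (z p)"
      using beta by (intro mult_right_mono) auto
    finally show "norm (Q p - z p) \<le> norm (z p) / 2" by simp
  qed
  \<comment> \<open>The sign a = 1 belongs to the angle \<psi>, and a = -1 to \<psi> - pi and \<psi>
    + pi. The size of \<open>b\<close> comes from heights at least \<Delta>1 and
    \<open>\<Delta>1 powr X = k powr X * \<Delta>2 powr (c * X)\<close>, the quantity in the choice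
    of \<Delta>2.\<close>
  have second: "\<exists>b>2 * \<Delta>2. z p = (0, a * b) \<and> norm (z p) = b"
    if p: "p \<in> ?R" and a: "\<bar>a\<bar> = 1" "cos (\<Phi> p) = a * cos \<psi>" "sin (\<Phi> p) = a * sin \<psi>" for p a
  proof -
    let ?y = "inner_map G (Kmap E p)"
    define b where "b = norm (PL ?y) / norm w"
    have "0 < snd p powr X" using height[OF p] by simp
    then have y_pos: "0 < norm (PL ?y)" using radius(2)[OF p] by linarith
    have "PL ?y /\<^sub>R norm (PL ?y) = a *\<^sub>R vector [cos \<psi>, sin \<psi>, 0]"
      unfolding direction[OF p] a by (simp add: vec_eq_iff forall_3)
    then have "norm (PL ?y) *\<^sub>R (PL ?y /\<^sub>R norm (PL ?y)) = norm (PL ?y) *\<^sub>R (a *\<^sub>R (w /\<^sub>R norm w))"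
      unfolding psi(2) by simp
    then have "PL ?y = (a * b) *\<^sub>R w"
      using y_pos by (simp add: b_def divide_inverse mult_ac)
    then have z: "z p = (0, a * b)"
      unfolding z_def by (rule kappa_scaled_w[OF kappa_rules])
    have "0 < b" using y_pos \<open>w \<noteq> 0\<close> by (simp add: b_def)
    then have norm_z: "norm (z p) = b" using a(1) by (simp add: z norm_Pair abs_mult)
    have "k powr X * \<Delta>2 powr (c * X) = \<Delta>1 powr X"
      unfolding Delta1 using \<open>0 < k\<close> by (simp add: powr_mult powr_powr)
    also have "\<dots> \<le> snd p powr X"
      using height[OF p] \<Delta>1 X_pos by (intro powr_mono2) auto
    also have "\<dots> \<le> onorm (kappa_inv v w) * b"
      using order_trans[OF radius(2)[OF p] norm_PL_le_kappa[OF kappa_rules]] norm_z unfolding z_def by simp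
    finally have low: "k powr X * \<Delta>2 powr (c * X) \<le> onorm (kappa_inv v w) * b" .
    have "0 \<le> onorm (kappa_inv v w)"
      by (rule onorm_pos_le[OF bounded_linear_kappa_inv[OF kappa_rules]])
    moreover have D: "2 * sqrt 2 * \<Delta>2 < 1 / onorm (kappa_inv v w) * (k powr X * \<Delta>2 powr (c * X))"
      using Delta2(3) by (simp add: X_def mult.assoc)
    moreover have "0 < 2 * sqrt 2 * \<Delta>2"
      using Delta2(1) by simp
    \<comment> \<open>Were this norm 0, the quotient in \<open>D\<close> would be 0 by convention,
      against \<Delta>2 > 0.\<close>
    ultimately have on_pos: "0 < onorm (kappa_inv v w)"
      by (cases "onorm (kappa_inv v w) = 0") auto
    have "1 / onorm (kappa_inv v w) * (k powr X * \<Delta>2 powr (c * X))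
        \<le> 1 / onorm (kappa_inv v w) * (onorm (kappa_inv v w) * b)"
      using low on_pos by (intro mult_left_mono) auto
    also have "\<dots> = b" using on_pos by simp
    finally have "2 * sqrt 2 * \<Delta>2 < b" using D by linarith
    moreover have "2 * 1 * \<Delta>2 \<le> 2 * sqrt 2 * \<Delta>2"
      using Delta2(1) by (intro mult_right_mono mult_left_mono) auto
    ultimately show ?thesis using z norm_z by (intro exI[of _ b]) auto
  qed
  have snd_near: "\<bar>snd (Q p) - snd (z p)\<bar> \<le> norm (z p) / 2" if "p \<in> ?R" for p
  proof -
    have "\<bar>snd (Q p - z p)\<bar> \<le> norm (Q p - z p)"
      by (metis norm_snd_le prod.collapse real_norm_def)
    then show ?thesis using Q_near(1)[OF that] by simp
  qed
  have high: "\<Delta>2 < snd (Q p)" if p: "p \<in> ?R" "\<Phi> p = \<psi>" for p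
  proof -
    obtain b where b: "2 * \<Delta>2 < b" "z p = (0, 1 * b)" "norm (z p) = b"
      using second[OF p(1), of 1] p(2) by auto
    have "\<bar>snd (Q p) - b\<bar> \<le> b / 2"
      using snd_near[OF p(1)] unfolding b(3) unfolding b(2) by simp
    then show ?thesis using b(1) by linarith
  qed
  have low: "snd (Q p) < \<Delta>1" if p: "p \<in> ?R" "\<Phi> p = \<psi> - pi \<or> \<Phi> p = \<psi> + pi" for p
  proof -
    obtain b where b: "2 * \<Delta>2 < b" "z p = (0, - 1 * b)" "norm (z p) = b"
      using second[OF p(1), of "- 1"] p(2) by (auto simp: cos_diff sin_diff)
    have "\<bar>snd (Q p) + b\<bar> \<le> b / 2"
      using snd_near[OF p(1)] unfolding b(3) unfolding b(2) by simp
    then show ?thesis using b(1) Delta2(1) \<Delta>1(2) by linarith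
  qed
  \<comment> \<open>Real suprema and infima bound the values only for bounded sets, so compactness
    of the two edges is used.\<close>
  have edges: "\<Phi> (x, \<Delta>1) \<le> m1" "m2 \<le> \<Phi> (x, \<Delta>2)" if "x \<in> {-\<alpha>..\<alpha>}" for x
  proof -
    have "compact ((\<lambda>x. \<Phi> (x, d)) ` {-\<alpha>..\<alpha>})" if "d \<in> {\<Delta>1..\<Delta>2}" for d
      using that by (intro compact_continuous_image continuous_on_compose2[OF cont_\<Phi>] continuous_intros) auto
    from compact_imp_bounded[OF this] have
      "bdd_above ((\<lambda>x. \<Phi> (x, \<Delta>1)) ` {-\<alpha>..\<alpha>})" "bdd_below ((\<lambda>x. \<Phi> (x, \<Delta>2)) ` {-\<alpha>..\<alpha>})"
      using \<Delta>1 by (auto intro: bounded_imp_bdd_above bounded_imp_bdd_below)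
    then show "\<Phi> (x, \<Delta>1) \<le> m1" "m2 \<le> \<Phi> (x, \<Delta>2)"
      unfolding m1 m2 using that by (auto intro: cSUP_upper cINF_lower)
  qed

  \<comment> \<open>\<open>True\<close> stands for the symbol 1. The choice of \<psi> places both
    angle intervals between \<open>m1\<close> and \<open>m2\<close>; the first is mapped upwards and
    the second downwards as the angle increases.\<close>
  define lo hi where "lo i = (if i then \<psi> else \<psi> - pi)" and "hi i = (if i then \<psi> + pi else \<psi>)" for i
  interpret rectangle_horseshoe \<alpha> \<Delta>1 \<Delta>2 Q \<Phi> lo hi
  proof
    show "fst (Q p) \<in> {-\<alpha>..\<alpha>}" if "p \<in> ?R" for p
    proof -
      have "norm (Q p) \<le> norm (z p) + norm (Q p - z p)" by (rule norm_triangle_sub)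
      then have "norm (Q p) \<le> \<alpha>" using Q_near[OF that] by linarith
      then show ?thesis using norm_fst_le[of "fst (Q p)" "snd (Q p)"] by auto
    qed
    show "(\<forall>p\<in>?R. (\<Phi> p = lo i \<longrightarrow> snd (Q p) < \<Delta>1) \<and> (\<Phi> p = hi i \<longrightarrow> \<Delta>2 < snd (Q p)))
      \<or> (\<forall>p\<in>?R. (\<Phi> p = lo i \<longrightarrow> \<Delta>2 < snd (Q p)) \<and> (\<Phi> p = hi i \<longrightarrow> snd (Q p) < \<Delta>1))" for i
      using high low unfolding lo_def hi_def by (cases i) (simp_all only: if_True if_False, blast+)
    show "lo i < hi i" for i by (simp add: lo_def hi_def)
    show "\<Phi> (x, \<Delta>1) \<le> lo i" if "x \<in> {-\<alpha>..\<alpha>}" for x i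
      using edges(1)[OF that] psi(1) pi_gt_zero unfolding lo_def atLeastAtMost_iff
      by (cases i; simp only: if_True if_False; linarith)
    show "hi i \<le> \<Phi> (x, \<Delta>2)" if "x \<in> {-\<alpha>..\<alpha>}" for x i
      using edges(2)[OF that] psi(1) pi_gt_zero unfolding hi_def atLeastAtMost_iff
      by (cases i; simp only: if_True if_False; linarith)
  qed (use \<alpha> \<Delta>1 cont_Q cont_\<Phi> in auto)
  obtain y where y: "\<And>n. y (n + 1) = Q (y n)" "\<And>n. y n \<in> ?R"
    "\<And>n. lo (s n \<noteq> 0) < \<Phi> (y n)" "\<And>n. \<Phi> (y n) < hi (s n \<noteq> 0)"
    using all_itineraries_realized[of "\<lambda>n. s n \<noteq> 0"] by blast
  have "y n \<in> (if s n = 0 then M0 \<Phi> \<alpha> \<Delta>1 \<Delta>2 \<psi> else M1 \<Phi> \<alpha> \<Delta>1 \<Delta>2 \<psi>)" for n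
    using y(2-4)[of n] by (auto simp: M0_def M1_def lo_def hi_def)
  then show "\<exists>y. \<forall>n. y (n + 1) = return_map (scaled F (\<epsilon> j)) E (y n) \<and>
      y n \<in> (if s n = 0 then M0 \<Phi> \<alpha> \<Delta>1 \<Delta>2 \<psi> else M1 \<Phi> \<alpha> \<Delta>1 \<Delta>2 \<psi>)"
    using y(1) unfolding Q_def G_def e_def by blast
qed

end
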